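(* Let $\alpha,\beta\in(1,2)$, $K_\alpha,K_\beta>0$, $L_a,L_b,T>0$. The finite difference scheme $$\mathcal{L}_x\mathcal{L}_y\delta_tu_{i,j}^{k+\frac12}=-\mathcal{L}_x\mathcal{L}_yu_{i,j}^{k+\frac12}+K_\alpha\mathcal{L}_y\delta_x^\alpha u_{i,j}^{k+\frac12}+K_\beta\mathcal{L}_x\delta_y^\beta u_{i,j}^{k+\frac12}+\mathcal{L}_x\mathcal{L}_yf_{i,j}^{k+\frac12},$$ $1\le i\le M_a-1$, $1\le j\le M_b-1$, $0\le k\le N-1$, with $$u_{i,j}^0=u^0(x_i,y_j),\ (x_i,y_j)\in\overline\Omega_h,\qquad u_{i,j}^k=0,\ (x_i,y_j)\in\partial\Omega_h,\ 1\le k\le N,$$ is unconditionally stable with respect to the initial values. That is, there is a constant $C>0$ independent of $\tau,h_a,h_b$ and $k$ such that for all positive integers $M_a,M_b,N$, if $\{u_{i,j}^k\}$ solves this scheme and $\{v_{i,j}^k\}$ solves the same scheme with initial values replaced by $v_{i,j}^0=u^0(x_i,y_j)+\varepsilon_{i,j}$, where $\boldsymbol\varepsilon\in\mathcal{V}_{h_a,h_b}$, then $\|\boldsymbol v^k-\boldsymbol u^k\|\le C\|\boldsymbol\varepsilon\|$ for all $0\le k\le N$.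
   Context: Grid: $\tau=T/N$, $h_a=L_a/M_a$, $h_b=L_b/M_b$, $t_k=k\tau$, $t_{k+\frac12}=(k+\frac12)\tau$, $x_i=ih_a$, $y_j=jh_b$; $\Omega=(0,L_a)\times(0,L_b)$, $\overline\Omega_h=\{(x_i,y_j):0\le i\le M_a,0\le j\le M_b\}$, $\Omega_h=\overline\Omega_h\cap\Omega$, $\partial\Omega_h=\overline\Omega_h\cap\partial\Omega$. The functions $f(x,y,t)$ and $u^0(x,y)$ are given and suitably smooth, $f_{i,j}^{k+\frac12}=f(x_i,y_j,t_{k+\frac12})$. Notation: $\delta_tu_{i,j}^{k+\frac12}=\frac{u_{i,j}^{k+1}-u_{i,j}^k}{\tau}$, $u_{i,j}^{k+\frac12}=\frac{u_{i,j}^{k+1}+u_{i,j}^k}{2}$. For $\gamma\in(1,2)$ put $\sigma_2^{(\gamma)}=-\frac{2\gamma^2-6\gamma+3}{6\gamma}$ and define $\kappa_{2,\ell}^{(\gamma)}$ by $\left(\frac{3\gamma-2}{2\gamma}-\frac{2(\gamma-1)}{\gamma}z+\frac{\gamma-2}{2\gamma}z^2\right)^{\gamma}=\sum_{\ell=0}^{\infty}\kappa_{2,\ell}^{(\gamma)}z^\ell$, $|z|<1$. Then $$\mathcal{L}_xw_{i,j}=w_{i,j}+\sigma_2^{(\alpha)}(w_{i+1,j}-2w_{i,j}+w_{i-1,j}),\qquad \mathcal{L}_yw_{i,j}=w_{i,j}+\sigma_2^{(\beta)}(w_{i,j+1}-2w_{i,j}+w_{i,j-1}),$$ $$\delta_x^\alpha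 w_{i,j}=-\frac{1}{2\cos(\frac{\pi\alpha}{2})h_a^\alpha}\left(\sum_{\ell=0}^{i+1}\kappa_{2,\ell}^{(\alpha)}w_{i-\ell+1,j}+\sum_{\ell=0}^{M_a-i+1}\kappa_{2,\ell}^{(\alpha)}w_{i+\ell-1,j}\right),$$ $$\delta_y^\beta w_{i,j}=-\frac{1}{2\cos(\frac{\pi\beta}{2})h_b^\beta}\left(\sum_{\ell=0}^{j+1}\kappa_{2,\ell}^{(\beta)}w_{i,j-\ell+1}+\sum_{\ell=0}^{M_b-j+1}\kappa_{2,\ell}^{(\beta)}w_{i,j+\ell-1}\right).$$ $\mathcal{V}_{h_a,h_b}$ is the space of real grid functions $\boldsymbol v=\{v_{i,j}\}$ with $v_{i,j}=0$ whenever $(x_i,y_j)\in\partial\Omega_h$, with $(\boldsymbol u,\boldsymbol v)=h_ah_b\sum_{i=1}^{M_a-1}\sum_{j=1}^{M_b-1}u_{i,j}v_{i,j}$ and $\|\boldsymbol u\|^2=(\boldsymbol u,\boldsymbol u)$. *)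

theory Defs
  imports "HOL-Complex_Analysis.Complex_Analysis"
begin

definition sigma2 :: "real \<Rightarrow> real" where
  "sigma2 \<gamma> = - (2 * \<gamma>\<^sup>2 - 6 * \<gamma> + 3) / (6 * \<gamma>)"

definition gen_base :: "real \<Rightarrow> complex \<Rightarrow> complex" where
  "gen_base \<gamma> z = of_real ((3 * \<gamma> - 2) / (2 * \<gamma>)) - of_real (2 * (\<gamma> - 1) / \<gamma>) * z
     + of_real ((\<gamma> - 2) / (2 * \<gamma>)) * z\<^sup>2"

text \<open>The power is the principal branch; for \<open>1 < \<gamma> < 2\<close> the base avoids the branch cut on the
  open unit disc, and the coefficient sequence exists uniquely: see \<open>kappa2_sums\<close> and
  \<open>kappa2_unique\<close> below.\<close>

definition kappa2 :: "real \<Rightarrow> nat \<Rightarrow> real" where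
  "kappa2 \<gamma> = (THE c. \<forall>z::complex. norm z < 1 \<longrightarrow>
     (\<lambda>l. of_real (c l) * z ^ l) sums (gen_base \<gamma> z powr of_real \<gamma>))"

lemma gen_base_not_nonpos:
  assumes "1 < \<gamma>" "\<gamma> < 2" "norm z < 1"
  shows "gen_base \<gamma> z \<notin> \<real>\<^sub>\<le>\<^sub>0"
proof
  assume np: "gen_base \<gamma> z \<in> \<real>\<^sub>\<le>\<^sub>0"
  define a where "a = (3 * \<gamma> - 2) / (2 * \<gamma>)"
  define d where "d = (2 - \<gamma>) / (2 * \<gamma>)"
  have d: "d > 0" "a > d" using assms by (auto simp: a_def d_def field_simps)
  define p where "p = 1 - z"
  define q where "q = of_real a + of_real d * z"
  have eq: "gen_base \<gamma> z = p * q"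
  proof -
    have "2 * (\<gamma> - 1) / \<gamma> = a - d" "(\<gamma> - 2) / (2 * \<gamma>) = - d"
      using assms by (auto simp: a_def d_def field_simps)
    then show ?thesis
      unfolding gen_base_def p_def q_def a_def[symmetric]
      by (simp only: of_real_diff of_real_minus) (simp add: algebra_simps power2_eq_square)
  qed
  have rz: "\<bar>Re z\<bar> < 1" using assms(3) abs_Re_le_cmod[of z] by linarith
  have rp: "Re p > 0" using rz by (simp add: p_def)
  have "d * (1 + Re z) > 0" using d rz by (intro mult_pos_pos) auto
  then have "d + d * Re z > 0" by (simp add: algebra_simps)
  then have rq: "Re q > 0" using d by (simp add: q_def)
  have im: "Re p * Im q + Im p * Re q = 0" and re: "Re p * Re q - Im p * Im q \<le> 0"
    using np unfolding eq by (auto simp: complex_nonpos_Reals_iff)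
  have "Re p * (Re p * Re q - Im p * Im q) = Re q * ((Re p)\<^sup>2 + (Im p)\<^sup>2)
      - Im p * (Re p * Im q + Im p * Re q)"
    by (simp add: algebra_simps power2_eq_square)
  also have "\<dots> = Re q * ((Re p)\<^sup>2 + (Im p)\<^sup>2)" by (simp add: im)
  also have "\<dots> > 0" using rp rq by (intro mult_pos_pos add_pos_nonneg) auto
  finally have "Re p * (Re p * Re q - Im p * Im q) > 0" .
  with rp re show False by (simp add: zero_less_mult_iff)
qed

lemma powser_disc_unique:
  fixes c c' :: "nat \<Rightarrow> complex"
  assumes "\<And>z. norm z < 1 \<Longrightarrow> (\<lambda>l. c l * z ^ l) sums g z"
    and "\<And>z. norm z < 1 \<Longrightarrow> (\<lambda>l. c' l * z ^ l) sums g z"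
  shows "c = c'"
proof -
  have ex: "g has_fps_expansion Abs_fps b"
    if "\<And>z. norm z < 1 \<Longrightarrow> (\<lambda>l. b l * z ^ l) sums g z" for b
  proof (rule has_fps_expansionI)
    have "eventually (\<lambda>z. z \<in> ball 0 1) (nhds (0::complex))"
      by (intro eventually_nhds_in_open) auto
    then show "\<forall>\<^sub>F z in nhds 0. (\<lambda>n. fps_nth (Abs_fps b) n * z ^ n) sums g z"
      by eventually_elim (use that in auto)
  qed
  have "Abs_fps c = Abs_fps c'"
    using fps_expansion_unique_complex[OF ex[OF assms(1)] ex[OF assms(2)]] by simp
  then show ?thesis by (simp add: fps_eq_iff fun_eq_iff)
qed

lemma kappa2_ex1:
  assumes "1 < \<gamma>" "\<gamma> < 2"
  shows "\<exists>!c. \<forall>z::complex. norm z < 1 \<longrightarrow>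
     (\<lambda>l. of_real (c l :: real) * z ^ l) sums (gen_base \<gamma> z powr of_real \<gamma>)"
proof -
  define g where "g = (\<lambda>z. gen_base \<gamma> z powr complex_of_real \<gamma>)"
  have hol: "g holomorphic_on ball 0 1"
  proof -
    have "gen_base \<gamma> holomorphic_on ball 0 1"
      unfolding gen_base_def by (intro holomorphic_intros)
    then show ?thesis
      unfolding g_def using gen_base_not_nonpos[OF assms] by (intro holomorphic_on_powr) auto
  qed
  define b where "b = (\<lambda>n. (deriv ^^ n) g 0 / fact n)"
  have b: "(\<lambda>n. b n * z ^ n) sums g z" if "norm z < 1" for z
    using holomorphic_power_series[OF hol, of z] that by (simp add: b_def)
  have cg: "cnj (g (cnj z)) = g z" if "norm z < 1" for z
  proof -
    have cb: "cnj (gen_base \<gamma> (cnj z)) = gen_base \<gamma> z" by (simp add: gen_base_def)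
    have "gen_base \<gamma> (cnj z) \<notin> \<real>\<^sub>\<le>\<^sub>0" using that by (intro gen_base_not_nonpos assms) auto
    then have "Im (gen_base \<gamma> (cnj z)) = 0 \<Longrightarrow> 0 \<le> Re (gen_base \<gamma> (cnj z))"
      by (auto simp: complex_nonpos_Reals_iff)
    from cnj_powr[OF this, of "complex_of_real \<gamma>"] show ?thesis
      by (simp add: g_def cb)
  qed
  have b': "(\<lambda>n. cnj (b n) * z ^ n) sums g z" if "norm z < 1" for z
  proof -
    have "(\<lambda>n. cnj (b n * cnj z ^ n)) sums cnj (g (cnj z))"
      using b[of "cnj z"] that by (simp only: sums_cnj) simp
    then show ?thesis using cg[OF that] by simp
  qed
  have "b = (\<lambda>n. cnj (b n))" using b b' by (rule powser_disc_unique)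
  then have "cnj (b n) = b n" for n by (metis (no_types))
  then have re: "complex_of_real (Re (b n)) = b n" for n
    by (metis Reals_cnj_iff of_real_Re)
  show ?thesis
  proof (rule ex1I[of _ "\<lambda>n. Re (b n)"])
    show "\<forall>z. norm z < 1 \<longrightarrow> (\<lambda>l. of_real (Re (b l)) * z ^ l) sums (gen_base \<gamma> z powr of_real \<gamma>)"
      using b by (simp add: re g_def)
  next
    fix c :: "nat \<Rightarrow> real"
    assume "\<forall>z. norm z < 1 \<longrightarrow> (\<lambda>l. of_real (c l) * z ^ l) sums (gen_base \<gamma> z powr of_real \<gamma>)"
    then have "(\<lambda>l. complex_of_real (c l)) = b"
      by (intro powser_disc_unique[of _ g]) (auto simp: g_def[symmetric] b, simp add: g_def)
    then show "c = (\<lambda>n. Re (b n))" by (metis Re_complex_of_real)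
  qed
qed

lemma kappa2_sums:
  assumes "1 < \<gamma>" "\<gamma> < 2" "norm z < 1"
  shows "(\<lambda>l. of_real (kappa2 \<gamma> l) * z ^ l) sums (gen_base \<gamma> z powr of_real \<gamma>)"
  using theI'[OF kappa2_ex1[OF assms(1,2)]] assms(3) unfolding kappa2_def by blast

lemma kappa2_unique:
  assumes "1 < \<gamma>" "\<gamma> < 2"
    and "\<And>z. norm z < 1 \<Longrightarrow> (\<lambda>l. of_real (c l) * z ^ l) sums (gen_base \<gamma> z powr of_real \<gamma>)"
  shows "kappa2 \<gamma> = c"
  unfolding kappa2_def by (rule the1_equality[OF kappa2_ex1[OF assms(1,2)]]) (use assms(3) in blast)

definition node :: "real \<Rightarrow> nat \<Rightarrow> nat \<Rightarrow> real" where
  "node L M i = real i * (L / real M)"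

definition half_time :: "real \<Rightarrow> nat \<Rightarrow> nat \<Rightarrow> real" where
  "half_time T N k = (real k + 1 / 2) * (T / real N)"

definition domain2d :: "real \<Rightarrow> real \<Rightarrow> (real \<times> real) set" where
  "domain2d L\<^sub>a L\<^sub>b = {0<..<L\<^sub>a} \<times> {0<..<L\<^sub>b}"

definition grid_closed :: "real \<Rightarrow> real \<Rightarrow> nat \<Rightarrow> nat \<Rightarrow> (real \<times> real) set" where
  "grid_closed L\<^sub>a L\<^sub>b M\<^sub>a M\<^sub>b = {(node L\<^sub>a M\<^sub>a i, node L\<^sub>b M\<^sub>b j) | i j. i \<le> M\<^sub>a \<and> j \<le> M\<^sub>b}"

definition grid_boundary :: "real \<Rightarrow> real \<Rightarrow> nat \<Rightarrow> nat \<Rightarrow> (real \<times> real) set" where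
  "grid_boundary L\<^sub>a L\<^sub>b M\<^sub>a M\<^sub>b = grid_closed L\<^sub>a L\<^sub>b M\<^sub>a M\<^sub>b \<inter> frontier (domain2d L\<^sub>a L\<^sub>b)"

lemma grid_boundary_iff:
  assumes "L\<^sub>a > 0" "L\<^sub>b > 0" "M\<^sub>a > 0" "M\<^sub>b > 0" "i \<le> M\<^sub>a" "j \<le> M\<^sub>b"
  shows "(node L\<^sub>a M\<^sub>a i, node L\<^sub>b M\<^sub>b j) \<in> grid_boundary L\<^sub>a L\<^sub>b M\<^sub>a M\<^sub>b
    \<longleftrightarrow> i = 0 \<or> i = M\<^sub>a \<or> j = 0 \<or> j = M\<^sub>b"
proof -
  have n: "0 \<le> node L M i" "node L M i \<le> L" "node L M i > 0 \<longleftrightarrow> i \<noteq> 0"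
    "node L M i < L \<longleftrightarrow> i \<noteq> M" if "L > 0" "M > 0" "i \<le> M" for L M i
    using that by (auto simp: node_def field_simps zero_less_mult_iff)
  have "(node L\<^sub>a M\<^sub>a i, node L\<^sub>b M\<^sub>b j) \<in> grid_closed L\<^sub>a L\<^sub>b M\<^sub>a M\<^sub>b"
    using assms(5,6) by (auto simp: grid_closed_def)
  then show ?thesis
    using assms n[OF assms(1,3,5)] n[OF assms(2,4,6)]
    by (auto simp: grid_boundary_def domain2d_def frontier_def closure_Times interior_Times)
qed

text \<open>A grid function is a total function on index pairs, of which only the values at indices
  \<open>0, \<dots>, M\<^sub>a\<close> and \<open>0, \<dots>, M\<^sub>b\<close> matter: the operators below are only applied at interior indices in
  their own direction, so that \<open>i - 1\<close> is never truncated, and \<open>w\<^bsub>i-l+1\<^esub>\<close> is written with index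
  \<open>i + 1 - l\<close> to include the endpoint \<open>l = i + 1\<close>.\<close>

type_synonym gridfun = "nat \<Rightarrow> nat \<Rightarrow> real"

definition op_Lx :: "real \<Rightarrow> gridfun \<Rightarrow> gridfun" where
  "op_Lx \<alpha> w i j = w i j + sigma2 \<alpha> * (w (i + 1) j - 2 * w i j + w (i - 1) j)"

definition op_Ly :: "real \<Rightarrow> gridfun \<Rightarrow> gridfun" where
  "op_Ly \<beta> w i j = w i j + sigma2 \<beta> * (w i (j + 1) - 2 * w i j + w i (j - 1))"

definition delta_x :: "real \<Rightarrow> real \<Rightarrow> nat \<Rightarrow> gridfun \<Rightarrow> gridfun" where
  "delta_x \<alpha> L\<^sub>a M\<^sub>a w i j =
     - 1 / (2 * cos (pi * \<alpha> / 2) * (L\<^sub>a / real M\<^sub>a) powr \<alpha>) *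
       ((\<Sum>l=0..i + 1. kappa2 \<alpha> l * w (i + 1 - l) j)
        + (\<Sum>l=0..M\<^sub>a - i + 1. kappa2 \<alpha> l * w (i + l - 1) j))"

definition delta_y :: "real \<Rightarrow> real \<Rightarrow> nat \<Rightarrow> gridfun \<Rightarrow> gridfun" where
  "delta_y \<beta> L\<^sub>b M\<^sub>b w i j =
     - 1 / (2 * cos (pi * \<beta> / 2) * (L\<^sub>b / real M\<^sub>b) powr \<beta>) *
       ((\<Sum>l=0..j + 1. kappa2 \<beta> l * w i (j + 1 - l))
        + (\<Sum>l=0..M\<^sub>b - j + 1. kappa2 \<beta> l * w i (j + l - 1)))"

definition delta_t :: "real \<Rightarrow> nat \<Rightarrow> (nat \<Rightarrow> gridfun) \<Rightarrow> nat \<Rightarrow> gridfun" where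
  "delta_t T N u k i j = (u (k + 1) i j - u k i j) / (T / real N)"

definition midpoint_t :: "(nat \<Rightarrow> gridfun) \<Rightarrow> nat \<Rightarrow> gridfun" where
  "midpoint_t u k i j = (u (k + 1) i j + u k i j) / 2"

text \<open>\<open>fd_solution \<alpha> \<beta> K\<^sub>\<alpha> K\<^sub>\<beta> L\<^sub>a L\<^sub>b T f M\<^sub>a M\<^sub>b N w0 u\<close>: the time levels \<open>u 0, \<dots>, u N\<close> solve the
  scheme with source term \<open>f x y t\<close> and initial grid values \<open>w0\<close>. The initial values are prescribed
  on the whole closed grid, the zero boundary values only from time level 1 on.\<close>

definition fd_solution ::
  "real \<Rightarrow> real \<Rightarrow> real \<Rightarrow> real \<Rightarrow> real \<Rightarrow> real \<Rightarrow> real \<Rightarrow> (real \<Rightarrow> real \<Rightarrow> real \<Rightarrow> real) \<Rightarrow>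
   nat \<Rightarrow> nat \<Rightarrow> nat \<Rightarrow> gridfun \<Rightarrow> (nat \<Rightarrow> gridfun) \<Rightarrow> bool" where
  "fd_solution \<alpha> \<beta> K\<^sub>\<alpha> K\<^sub>\<beta> L\<^sub>a L\<^sub>b T f M\<^sub>a M\<^sub>b N w0 u \<longleftrightarrow>
     (\<forall>i j k. 1 \<le> i \<and> i \<le> M\<^sub>a - 1 \<and> 1 \<le> j \<and> j \<le> M\<^sub>b - 1 \<and> k \<le> N - 1 \<longrightarrow>
        op_Lx \<alpha> (op_Ly \<beta> (delta_t T N u k)) i j =
          - op_Lx \<alpha> (op_Ly \<beta> (midpoint_t u k)) i j
          + K\<^sub>\<alpha> * op_Ly \<beta> (delta_x \<alpha> L\<^sub>a M\<^sub>a (midpoint_t u k)) i j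
          + K\<^sub>\<beta> * op_Lx \<alpha> (delta_y \<beta> L\<^sub>b M\<^sub>b (midpoint_t u k)) i j
          + op_Lx \<alpha> (op_Ly \<beta>
              (\<lambda>i j. f (node L\<^sub>a M\<^sub>a i) (node L\<^sub>b M\<^sub>b j) (half_time T N k))) i j)
   \<and> (\<forall>i\<le>M\<^sub>a. \<forall>j\<le>M\<^sub>b. u 0 i j = w0 i j)
   \<and> (\<forall>i\<le>M\<^sub>a. \<forall>j\<le>M\<^sub>b. \<forall>k. 1 \<le> k \<and> k \<le> N \<and>
        (node L\<^sub>a M\<^sub>a i, node L\<^sub>b M\<^sub>b j) \<in> grid_boundary L\<^sub>a L\<^sub>b M\<^sub>a M\<^sub>b \<longrightarrow> u k i j = 0)"

definition grid_space :: "real \<Rightarrow> real \<Rightarrow> nat \<Rightarrow> nat \<Rightarrow> gridfun set" where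
  "grid_space L\<^sub>a L\<^sub>b M\<^sub>a M\<^sub>b = {v. \<forall>i\<le>M\<^sub>a. \<forall>j\<le>M\<^sub>b.
     (node L\<^sub>a M\<^sub>a i, node L\<^sub>b M\<^sub>b j) \<in> grid_boundary L\<^sub>a L\<^sub>b M\<^sub>a M\<^sub>b \<longrightarrow> v i j = 0}"

definition grid_inner :: "real \<Rightarrow> real \<Rightarrow> nat \<Rightarrow> nat \<Rightarrow> gridfun \<Rightarrow> gridfun \<Rightarrow> real" where
  "grid_inner L\<^sub>a L\<^sub>b M\<^sub>a M\<^sub>b u v =
     (L\<^sub>a / real M\<^sub>a) * (L\<^sub>b / real M\<^sub>b) * (\<Sum>i=1..M\<^sub>a - 1. \<Sum>j=1..M\<^sub>b - 1. u i j * v i j)"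

definition grid_norm :: "real \<Rightarrow> real \<Rightarrow> nat \<Rightarrow> nat \<Rightarrow> gridfun \<Rightarrow> real" where
  "grid_norm L\<^sub>a L\<^sub>b M\<^sub>a M\<^sub>b v = sqrt (grid_inner L\<^sub>a L\<^sub>b M\<^sub>a M\<^sub>b v v)"

end

theory Submission
  imports Defs
begin

text \<open>The proof is an energy estimate. The difference \<open>w\<close> of two solutions solves the homogeneous
  scheme with zero boundary values. Testing that scheme with the midpoint value
  \<open>m = (w\<^sup>k\<^sup>+\<^sup>1 + w\<^sup>k) / 2\<close> makes the left-hand side telescope to
  \<open>(E\<^sup>k\<^sup>+\<^sup>1 - E\<^sup>k) / (2 \<tau>)\<close> with the energy \<open>E\<^sup>k = (L\<^sub>x L\<^sub>y w\<^sup>k, w\<^sup>k)\<close>, because \<open>L\<^sub>x L\<^sub>y\<close> is symmetric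
  (\<open>energy_difference\<close>). All terms on the right are nonpositive, so the energy decreases
  (\<open>energy_step\<close>). Since \<open>0 \<le> \<sigma>\<^sub>2 < 1 / 4\<close>, the energy lies between
  \<open>(1 - 4 \<sigma>\<^sub>2(\<alpha>)) (1 - 4 \<sigma>\<^sub>2(\<beta>)) \<parallel>w\<parallel>\<^sup>2\<close> and \<open>\<parallel>w\<parallel>\<^sup>2\<close> (\<open>energy_bounds\<close>). Hence stability holds with a
  constant that depends on \<open>\<alpha>\<close> and \<open>\<beta>\<close> only.

  The main point is that the fractional difference \<open>\<delta>\<^sub>x\<^sup>\<alpha>\<close> is negative semidefinite
  (\<open>riesz_form_nonpos\<close>). Up to a nonnegative factor its quadratic form is that of a Toeplitz matrix, and by
  Cauchy's coefficient formula it equals the mean over \<open>\<bar>u\<bar> = 1\<close> of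
  \<open>Re (g(u) / u) \<bar>V(u)\<bar>\<^sup>2\<close>, where \<open>g\<close> generates the coefficients and \<open>V\<close> is the trigonometric
  polynomial of the grid function. The base of \<open>g\<close> factors as \<open>(1 - u) (1 - d + d u)\<close> with
  \<open>d = 1 / \<gamma> - 1 / 2\<close>; bounding the argument of the second factor by \<open>d \<theta>\<close> for
  \<open>u = e\<^sup>i\<^sup>\<theta>\<close>, \<open>0 < \<theta> \<le> \<pi>\<close>, places \<open>g(u) / u\<close> in the closed left half-plane (\<open>symbol_nonpos\<close>).

  The operators \<open>L\<^sub>x\<close>, \<open>L\<^sub>y\<close> combine with semidefinite operators in the other variable by
  \<open>tri_tensor_bounds\<close>: a tridiagonal form is a nonnegative combination of values of the given form
  on single rows and on sums of neighbouring rows.\<close>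

section \<open>The sign of the symbol on the unit circle\<close>

text \<open>The factor of the symbol base that remains after division by \<open>1 - z\<close>. For
  \<open>1 < \<gamma> < 2\<close> its coefficients are positive, with sum 1.\<close>

definition base_lin :: "real \<Rightarrow> complex \<Rightarrow> complex" where
  "base_lin \<gamma> z = of_real ((3 * \<gamma> - 2) / (2 * \<gamma>)) + of_real ((2 - \<gamma>) / (2 * \<gamma>)) * z"

lemma gen_base_factor:
  assumes "0 < \<gamma>"
  shows "gen_base \<gamma> z = (1 - z) * base_lin \<gamma> z"
proof -
  define a where "a = (3 * \<gamma> - 2) / (2 * \<gamma>)"
  define d where "d = (2 - \<gamma>) / (2 * \<gamma>)"
  have "2 * (\<gamma> - 1) / \<gamma> = a - d" "(\<gamma> - 2) / (2 * \<gamma>) = - d"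
    using assms by (auto simp: a_def d_def field_simps)
  then show ?thesis
    unfolding gen_base_def base_lin_def a_def[symmetric] d_def[symmetric]
    by (simp only: of_real_diff of_real_minus) (simp add: algebra_simps power2_eq_square)
qed

lemma Re_base_lin_pos:
  assumes "1 < \<gamma>" "\<gamma> < 2" "norm z \<le> 1"
  shows "Re (base_lin \<gamma> z) > 0"
proof -
  have "- 1 \<le> Re z" using assms(3) abs_Re_le_cmod[of z] by linarith
  then have "(2 - \<gamma>) / (2 * \<gamma>) * (- 1) \<le> (2 - \<gamma>) / (2 * \<gamma>) * Re z"
    using assms by (intro mult_left_mono) auto
  moreover have "(3 * \<gamma> - 2) / (2 * \<gamma>) > (2 - \<gamma>) / (2 * \<gamma>)"
    using assms by (simp add: field_simps)
  ultimately show ?thesis by (simp add: base_lin_def)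
qed

text \<open>On the closed disc the base stays off the negative real axis, because it is a product of one
  factor in the closed and one in the open right half-plane. So its power extends continuously to
  the unit circle, including the zero at \<open>z = 1\<close>.\<close>

lemma gen_base_cball:
  assumes "1 < \<gamma>" "\<gamma> < 2" "norm z \<le> 1"
  shows "Re (gen_base \<gamma> z) \<ge> 0 \<or> Im (gen_base \<gamma> z) \<noteq> 0"
proof (rule ccontr)
  define p q where "p = 1 - z" and "q = base_lin \<gamma> z"
  assume "\<not> ?thesis"
  moreover have "gen_base \<gamma> z = p * q"
    using assms by (simp add: p_def q_def gen_base_factor)
  ultimately have im: "Re p * Im q + Im p * Re q = 0" and re: "Re p * Re q - Im p * Im q < 0"
    by auto
  have p: "Re p \<ge> 0" using assms(3) abs_Re_le_cmod[of z] by (simp add: p_def)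
  have q: "Re q > 0" using assms by (simp add: q_def Re_base_lin_pos)
  have "Re q * (Re p * Re q - Im p * Im q) = Re p * ((Re q)\<^sup>2 + (Im q)\<^sup>2)
      - Im q * (Re p * Im q + Im p * Re q)"
    by (simp add: algebra_simps power2_eq_square)
  then have "Re q * (Re p * Re q - Im p * Im q) \<ge> 0" using p by (simp add: im)
  with q re show False by (simp add: zero_le_mult_iff)
qed

lemma gen_powr_continuous_on_cball:
  assumes "1 < \<gamma>" "\<gamma> < 2"
  shows "continuous_on (cball 0 1) (\<lambda>z. gen_base \<gamma> z powr of_real \<gamma>)"
proof (rule continuous_on_powr_complex)
  show "cball 0 1 \<subseteq> {z. 0 \<le> Re (gen_base \<gamma> z) \<or> Im (gen_base \<gamma> z) \<noteq> 0}"
    by (intro subsetI CollectI gen_base_cball[OF assms]) simp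
  show "continuous_on (cball 0 1) (gen_base \<gamma>)"
    unfolding gen_base_def by (intro continuous_intros)
qed (use assms in auto)

lemma gen_powr_holomorphic_on_ball:
  assumes "1 < \<gamma>" "\<gamma> < 2"
  shows "(\<lambda>z. gen_base \<gamma> z powr of_real \<gamma>) holomorphic_on ball 0 1"
proof -
  have "gen_base \<gamma> holomorphic_on ball 0 1"
    unfolding gen_base_def by (intro holomorphic_intros)
  then show ?thesis
    using gen_base_not_nonpos[OF assms] by (intro holomorphic_on_powr) auto
qed

lemma sin_ratio_mono:
  fixes d \<theta> :: real
  assumes "0 \<le> d" "d \<le> 1 / 2" "0 \<le> \<theta>" "\<theta> \<le> pi"
  shows "d * sin ((1 - d) * \<theta>) \<le> (1 - d) * sin (d * \<theta>)"
proof -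
  define F where "F t = (1 - d) * sin (d * t) - d * sin ((1 - d) * t)" for t
  have "F 0 \<le> F \<theta>"
  proof (rule DERIV_nonneg_imp_nondecreasing[OF assms(3)])
    fix t assume t: "0 \<le> t" "t \<le> \<theta>"
    have "(F has_real_derivative d * (1 - d) * (cos (d * t) - cos ((1 - d) * t))) (at t)"
      unfolding F_def by (auto intro!: derivative_eq_intros simp: algebra_simps)
    moreover have "d * (1 - d) * (cos (d * t) - cos ((1 - d) * t)) \<ge> 0"
    proof -
      have "(1 - d) * t \<le> 1 * pi" using t assms by (intro mult_mono) auto
      moreover have "d * t \<le> (1 - d) * t" using t assms by (intro mult_right_mono) auto
      ultimately have "cos ((1 - d) * t) \<le> cos (d * t)"
        using t assms by (intro cos_monotone_0_pi_le) auto
      then show ?thesis using assms by simp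
    qed
    ultimately show "\<exists>y. (F has_real_derivative y) (at t) \<and> 0 \<le> y" by blast
  qed
  then show ?thesis by (simp add: F_def)
qed

text \<open>Here \<open>base_lin \<gamma> z = (1 - d) + d z\<close> with \<open>d = 1 / \<gamma> - 1 / 2\<close>. Its argument at \<open>e\<^sup>i\<^sup>\<theta>\<close> is
  at most \<open>d \<theta>\<close>, its tangent bound at \<open>\<theta> = 0\<close>, since rotating it by \<open>- d \<theta>\<close> leads to an
  imaginary part that is nonpositive by \<open>sin_ratio_mono\<close>.\<close>

lemma Arg_base_lin_bounds:
  assumes "1 < \<gamma>" "\<gamma> < 2" "0 \<le> \<theta>" "\<theta> \<le> pi"
  shows "0 \<le> Arg (base_lin \<gamma> (cis \<theta>))" "Arg (base_lin \<gamma> (cis \<theta>)) \<le> (1 / \<gamma> - 1 / 2) * \<theta>"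
proof -
  define d where "d = 1 / \<gamma> - 1 / 2"
  have d: "0 < d" "d < 1 / 2" using assms by (auto simp: d_def field_simps)
  define q where "q = base_lin \<gamma> (cis \<theta>)"
  have "(3 * \<gamma> - 2) / (2 * \<gamma>) = 1 - d" "(2 - \<gamma>) / (2 * \<gamma>) = d"
    using assms by (auto simp: d_def field_simps)
  then have q: "q = of_real (1 - d) + of_real d * cis \<theta>"
    by (simp only: q_def base_lin_def)
  have req: "Re q > 0" unfolding q_def using assms by (intro Re_base_lin_pos) auto
  have imq: "Im q \<ge> 0" using d assms by (simp add: q sin_ge_zero)
  show "0 \<le> Arg (base_lin \<gamma> (cis \<theta>))"
    using Arg_neg_iff[of q] imq unfolding q_def[symmetric] by linarith
  have up: "\<bar>Arg q\<bar> < pi / 2" using Arg_Re_pos req by blast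
  have pol: "q = of_real (norm q) * cis (Arg q)"
    using rcis_cmod_Arg[of q] by (simp add: rcis_def)
  have sd: "sin ((1 - d) * \<theta>) = sin \<theta> * cos (d * \<theta>) - cos \<theta> * sin (d * \<theta>)"
    using sin_diff[of \<theta> "d * \<theta>"] by (simp add: algebra_simps)
  have "norm q * sin (Arg q - d * \<theta>) = Im (of_real (norm q) * cis (Arg q) * cis (- (d * \<theta>)))"
    by (simp add: mult.assoc cis_mult)
  also have "\<dots> = Im (q * cis (- (d * \<theta>)))" by (simp only: pol[symmetric])
  also have "\<dots> = d * sin ((1 - d) * \<theta>) - (1 - d) * sin (d * \<theta>)"
    unfolding sd by (simp add: q algebra_simps)
  also have "\<dots> \<le> 0" using sin_ratio_mono[of d \<theta>] d assms by simp
  finally have "norm q * sin (Arg q - d * \<theta>) \<le> 0" .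
  moreover have "norm q > 0" using req by auto
  ultimately have s: "sin (Arg q - d * \<theta>) \<le> 0" by (simp add: mult_le_0_iff)
  have "Arg q \<le> d * \<theta>"
  proof (rule ccontr)
    assume "\<not> Arg q \<le> d * \<theta>"
    then have "sin (Arg q - d * \<theta>) > 0"
      using up d assms by (intro sin_gt_zero) (auto simp: abs_less_iff intro: less_le_trans[of _ "pi/2"]
         order.strict_trans1[of _ "Arg q"])
    with s show False by simp
  qed
  then show "Arg (base_lin \<gamma> (cis \<theta>)) \<le> (1 / \<gamma> - 1 / 2) * \<theta>" by (simp add: q_def d_def)
qed

lemma one_minus_cis: "1 - cis \<theta> = of_real (2 * sin (\<theta> / 2)) * cis ((\<theta> - pi) / 2)"
proof -
  have s: "sin \<theta> = 2 * sin (\<theta> / 2) * cos (\<theta> / 2)" using sin_double[of "\<theta> / 2"] by simp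
  have c: "cos \<theta> = 1 - 2 * (sin (\<theta> / 2))\<^sup>2" using cos_double_sin[of "\<theta> / 2"] by simp
  show ?thesis
    by (rule complex_eqI)
      (simp_all add: s c diff_divide_distrib sin_diff cos_diff power2_eq_square)
qed

text \<open>The number in question has argument \<open>- X\<close> with
  \<open>X = \<gamma> (\<pi> - \<theta>) / 2 + \<theta> - \<gamma> \<phi>\<close>, where \<open>\<phi>\<close> is the argument of \<open>base_lin \<gamma> e\<^sup>i\<^sup>\<theta>\<close>. From
  \<open>0 \<le> \<phi> \<le> (1 / \<gamma> - 1 / 2) \<theta>\<close> follows \<open>\<gamma> \<pi> / 2 \<le> X \<le> \<pi>\<close>, so its cosine is nonpositive.\<close>

lemma symbol_nonpos_upper:
  assumes "1 < \<gamma>" "\<gamma> < 2" "0 < \<theta>" "\<theta> \<le> pi"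
  shows "Re (gen_base \<gamma> (cis \<theta>) powr of_real \<gamma> * cnj (cis \<theta>)) \<le> 0"
proof -
  define q where "q = base_lin \<gamma> (cis \<theta>)"
  define s where "s = 2 * sin (\<theta> / 2)"
  define \<psi> where "\<psi> = (\<theta> - pi) / 2 + Arg q"
  note arg = Arg_base_lin_bounds[OF assms(1,2) less_imp_le[OF assms(3)] assms(4), folded q_def]
  have req: "Re q > 0" unfolding q_def using assms by (intro Re_base_lin_pos) auto
  have s: "s > 0" using assms by (auto simp: s_def intro!: sin_gt_zero)
  have q0: "norm q > 0" using req by auto
  have argq: "\<bar>Arg q\<bar> < pi / 2" using Arg_Re_pos req by blast
  have "gen_base \<gamma> (cis \<theta>) = of_real s * cis ((\<theta> - pi) / 2) * (of_real (norm q) * cis (Arg q))"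
    using gen_base_factor[of \<gamma> "cis \<theta>"] one_minus_cis[of \<theta>] rcis_cmod_Arg[of q] assms
    by (simp add: q_def s_def rcis_def)
  also have "\<dots> = of_real (s * norm q) * cis \<psi>"
    by (simp add: \<psi>_def cis_mult[symmetric] mult_ac)
  also have "\<dots> = exp (of_real (ln (s * norm q)) + \<i> * of_real \<psi>)"
    using s q0 by (simp add: exp_add exp_of_real cis_conv_exp del: ln_mult_pos)
  finally have eq: "gen_base \<gamma> (cis \<theta>) = exp (of_real (ln (s * norm q)) + \<i> * of_real \<psi>)" .
  then have nz: "gen_base \<gamma> (cis \<theta>) \<noteq> 0" by simp
  from eq have ln: "Ln (gen_base \<gamma> (cis \<theta>)) = of_real (ln (s * norm q)) + \<i> * of_real \<psi>"
    using argq assms by (intro Ln_unique) (auto simp: \<psi>_def abs_less_iff field_simps)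
  have "gen_base \<gamma> (cis \<theta>) powr of_real \<gamma>
      = exp (of_real \<gamma> * (of_real (ln (s * norm q)) + \<i> * of_real \<psi>))"
    by (simp add: powr_def ln nz)
  also have "\<dots> = of_real (exp (\<gamma> * ln (s * norm q))) * cis (\<gamma> * \<psi>)"
    by (simp add: exp_of_real[symmetric] cis_conv_exp exp_add[symmetric] algebra_simps del: ln_mult_pos)
  finally have pw: "gen_base \<gamma> (cis \<theta>) powr of_real \<gamma> * cnj (cis \<theta>)
      = of_real (exp (\<gamma> * ln (s * norm q))) * cis (\<gamma> * \<psi> - \<theta>)"
    by (simp add: cis_cnj mult.assoc cis_mult)
  define X where "X = \<theta> - \<gamma> * \<psi>"
  have X: "X = \<gamma> * (pi - \<theta>) / 2 + \<theta> - \<gamma> * Arg q"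
    by (simp add: X_def \<psi>_def field_simps)
  have "\<gamma> * Arg q \<le> \<gamma> * ((1 / \<gamma> - 1 / 2) * \<theta>)" using assms arg by (intro mult_left_mono) auto
  also have "\<dots> = \<theta> - \<gamma> * \<theta> / 2" using assms by (simp add: field_simps)
  finally have "X \<ge> \<gamma> * pi / 2" by (simp add: X algebra_simps diff_divide_distrib)
  moreover have "\<gamma> * pi \<ge> 1 * pi" using assms by (intro mult_right_mono) auto
  ultimately have X1: "X \<ge> pi / 2" by linarith
  have "\<gamma> * (pi - \<theta>) \<le> 2 * (pi - \<theta>)" using assms by (intro mult_right_mono) auto
  moreover have "\<gamma> * Arg q \<ge> 0" using assms arg by simp
  ultimately have X2: "X \<le> pi" by (simp add: X)
  have "cos (pi - X) \<ge> 0" using X1 X2 by (intro cos_ge_zero) auto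
  then have "cos X \<le> 0" by simp
  then have "cos (\<gamma> * \<psi> - \<theta>) \<le> 0" unfolding X_def by (metis cos_minus minus_diff_eq)
  then show ?thesis unfolding pw by (simp add: mult_le_0_iff)
qed

text \<open>On the unit circle this real part is the generating function of the symmetric part of the
  Toeplitz matrix of the shifted coefficients. The lower half of the circle follows by conjugation.\<close>

lemma symbol_nonpos:
  assumes "1 < \<gamma>" "\<gamma> < 2" "norm u = 1"
  shows "Re (gen_base \<gamma> u powr of_real \<gamma> * cnj u) \<le> 0"
proof -
  have u: "u = cis (Arg u)" using rcis_cmod_Arg[of u] assms by (simp add: rcis_def)
  have "- pi < Arg u" "Arg u \<le> pi" by (rule mpi_less_Arg, rule Arg_le_pi)
  then consider "Arg u = 0" | "0 < Arg u" "Arg u \<le> pi" | "0 < - Arg u" "- Arg u \<le> pi" by linarith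
  then show ?thesis
  proof cases
    case 1
    then have "u = 1" using u by simp
    then show ?thesis using assms by (simp add: gen_base_factor)
  next
    case 2
    then show ?thesis using symbol_nonpos_upper[OF assms(1,2) 2] u by simp
  next
    case 3
    have cu: "cis (- Arg u) = cnj u" using u by (metis cis_cnj)
    have "gen_base \<gamma> (cnj u) powr of_real \<gamma> = cnj (gen_base \<gamma> u powr of_real \<gamma>)"
      using gen_base_cball[OF assms(1,2), of u] assms
      by (subst cnj_powr) (auto simp: gen_base_def)
    with symbol_nonpos_upper[OF assms(1,2) 3] show ?thesis by (simp add: cu)
  qed
qed

section \<open>The Toeplitz form of the fractional difference\<close>

text \<open>The Toeplitz matrix of the left-sided weighted and shifted difference: entry \<open>(i, m)\<close> is
  \<open>\<kappa>\<^bsub>i + 1 - m\<^esub>\<close>, and 0 where the index would be negative.\<close>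

definition shifted_coeff :: "real \<Rightarrow> nat \<Rightarrow> nat \<Rightarrow> real" where
  "shifted_coeff \<gamma> i m = (if m \<le> i + 1 then kappa2 \<gamma> (i + 1 - m) else 0)"

lemma higher_deriv_gen_powr:
  assumes "1 < \<gamma>" "\<gamma> < 2"
  shows "(deriv ^^ n) (\<lambda>z. gen_base \<gamma> z powr of_real \<gamma>) 0 = fact n * of_real (kappa2 \<gamma> n)"
proof -
  have "(\<lambda>n. (deriv ^^ n) (\<lambda>z. gen_base \<gamma> z powr of_real \<gamma>) 0 / fact n)
      = (\<lambda>n. complex_of_real (kappa2 \<gamma> n))"
    using holomorphic_power_series[OF gen_powr_holomorphic_on_ball[OF assms]] kappa2_sums[OF assms]
    by (intro powser_disc_unique[of _ "\<lambda>z. gen_base \<gamma> z powr of_real \<gamma>"]) simp_all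
  from fun_cong[OF this, of n] show ?thesis by (simp add: field_simps)
qed

text \<open>Cauchy's coefficient formula on the unit circle itself, where the symbol is continuous up to
  the boundary but need not be analytic. The zero entries come from the same formula.\<close>

lemma shifted_coeff_contour_integral:
  assumes "1 < \<gamma>" "\<gamma> < 2"
  shows "((\<lambda>u. gen_base \<gamma> u powr of_real \<gamma> * u ^ m / u ^ (i + 2)) has_contour_integral
           2 * pi * \<i> * of_real (shifted_coeff \<gamma> i m)) (circlepath 0 1)"
proof -
  note cont = gen_powr_continuous_on_cball[OF assms]
  note hol = gen_powr_holomorphic_on_ball[OF assms]
  let ?g = "\<lambda>z. gen_base \<gamma> z powr of_real \<gamma>"
  show ?thesis
  proof (cases "m \<le> i + 1")
    case True
    define n where "n = i + 1 - m"
    have i: "i + 2 = Suc n + m" using True by (simp add: n_def)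
    have "((\<lambda>u. ?g u / (u - 0) ^ Suc n) has_contour_integral
        2 * pi * \<i> / fact n * (deriv ^^ n) ?g 0) (circlepath 0 1)"
      by (rule Cauchy_has_contour_integral_higher_derivative_circlepath[OF cont hol]) simp
    moreover have "2 * pi * \<i> / fact n * (deriv ^^ n) ?g 0 = 2 * pi * \<i> * of_real (shifted_coeff \<gamma> i m)"
      using True by (simp add: shifted_coeff_def n_def higher_deriv_gen_powr[OF assms])
    moreover have "?g z * z ^ m / z ^ (i + 2) = ?g z / (z - 0) ^ Suc n" if "norm z = 1" for z
      using that unfolding i power_add by auto
    ultimately show ?thesis
      by (subst has_contour_integral_cong[of _ _ "\<lambda>u. ?g u / (u - 0) ^ Suc n", OF _ refl refl]) simp_all
  next
    case False
    define n where "n = m - (i + 2)"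
    have m: "m = n + (i + 2)" using False by (simp add: n_def)
    \<comment> \<open>one surplus factor \<open>u\<close> turns the integrand into a Cauchy kernel for a function
      that vanishes at 0\<close>
    have "((\<lambda>u. (?g u * u ^ Suc n) / (u - 0) ^ Suc 0) has_contour_integral
        2 * pi * \<i> / fact 0 * (deriv ^^ 0) (\<lambda>u. ?g u * u ^ Suc n) 0) (circlepath 0 1)"
      by (rule Cauchy_has_contour_integral_higher_derivative_circlepath)
        (auto intro!: continuous_intros holomorphic_intros cont hol simp del: power_Suc)
    then show ?thesis
      by (rule has_contour_integral_cong[THEN iffD1, rotated -1])
        (use False in \<open>auto simp: m power_add shifted_coeff_def\<close>)
  qed
qed

text \<open>With \<open>V u = (\<Sum>m\<in>I. f m * u ^ m)\<close> the quadratic form is the mean over the unit circle of the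
  nonpositive real part in \<open>symbol_nonpos\<close>, weighted with \<open>\<bar>V u\<bar>\<^sup>2\<close>.\<close>

lemma shifted_coeff_form_nonpos:
  assumes "1 < \<gamma>" "\<gamma> < 2" "finite I"
  shows "(\<Sum>i\<in>I. \<Sum>m\<in>I. shifted_coeff \<gamma> i m * f m * f i) \<le> 0"
proof -
  let ?g = "\<lambda>z. gen_base \<gamma> z powr of_real \<gamma>"
  let ?S = "\<Sum>i\<in>I. \<Sum>m\<in>I. shifted_coeff \<gamma> i m * f m * f i"
  define V where "V u = (\<Sum>m\<in>I. of_real (f m) * u ^ m)" for u :: complex
  have "((\<lambda>u. \<Sum>i\<in>I. \<Sum>m\<in>I. of_real (f m * f i) * (?g u * u ^ m / u ^ (i + 2))) has_contour_integral
      (\<Sum>i\<in>I. \<Sum>m\<in>I. of_real (f m * f i) * (2 * pi * \<i> * of_real (shifted_coeff \<gamma> i m)))) (circlepath 0 1)"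
    using assms
    by (intro has_contour_integral_sum has_contour_integral_lmul shifted_coeff_contour_integral)
  also have "(\<Sum>i\<in>I. \<Sum>m\<in>I. of_real (f m * f i) * (2 * pi * \<i> * of_real (shifted_coeff \<gamma> i m)))
      = 2 * pi * \<i> * of_real ?S"
    by (simp add: sum_distrib_left mult_ac)
  finally have "((\<lambda>t. (\<Sum>i\<in>I. \<Sum>m\<in>I. of_real (f m * f i) *
       (?g (circlepath 0 1 t) * circlepath 0 1 t ^ m / circlepath 0 1 t ^ (i + 2)))
       * vector_derivative (circlepath 0 1) (at t)) has_integral 2 * pi * \<i> * of_real ?S) {0..1}"
    by (simp only: has_contour_integral)
  from has_integral_mult_right[OF this, of "1 / (2 * pi * \<i>)"]
  have "((\<lambda>t. ?g (circlepath 0 1 t) * cnj (circlepath 0 1 t) * of_real ((norm (V (circlepath 0 1 t)))\<^sup>2))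
       has_integral of_real ?S) {0..1}"
  proof (rule has_integral_eq_rhs[OF has_integral_eq, rotated])
    fix t :: real
    define u where "u = circlepath 0 1 t"
    have nu: "norm u = 1" by (simp add: u_def circlepath)
    then have u0: "u \<noteq> 0" by auto
    have inv: "cnj u = inverse u" using nu
      by (metis inverse_unique complex_norm_square of_real_1 power_one)
    have vd: "vector_derivative (circlepath 0 1) (at t) = 2 * pi * \<i> * u"
      by (simp only: vector_derivative_circlepath u_def) (simp add: circlepath)
    have cancel: "1 / (2 * pi * \<i>) * (S * (2 * pi * \<i> * u)) = S * u" for S
      by (simp add: field_simps)
    have cV: "cnj (V u) = (\<Sum>i\<in>I. of_real (f i) / u ^ i)"
      by (simp add: V_def inv power_inverse divide_inverse)
    have "of_real ((norm (V u))\<^sup>2) = cnj (V u) * V u"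
      unfolding complex_norm_square by (rule mult.commute)
    also have "\<dots> = (\<Sum>i\<in>I. \<Sum>m\<in>I. of_real (f m * f i) * (u ^ m / u ^ i))"
      unfolding cV unfolding V_def sum_product by (intro sum.cong refl) simp
    finally have "?g u * cnj u * of_real ((norm (V u))\<^sup>2)
        = ?g u * inverse u * (\<Sum>i\<in>I. \<Sum>m\<in>I. of_real (f m * f i) * (u ^ m / u ^ i))"
      by (simp only: inv)
    also have "\<dots> = (\<Sum>i\<in>I. \<Sum>m\<in>I. of_real (f m * f i) * (?g u * u ^ m / u ^ (i + 2))) * u"
      unfolding sum_distrib_left sum_distrib_right
      using u0 by (intro sum.cong refl) (simp add: divide_simps)
    finally have "?g u * cnj u * of_real ((norm (V u))\<^sup>2)
        = (\<Sum>i\<in>I. \<Sum>m\<in>I. of_real (f m * f i) * (?g u * u ^ m / u ^ (i + 2))) * u" .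
    then show "1 / (2 * pi * \<i>) * ((\<Sum>i\<in>I. \<Sum>m\<in>I. of_real (f m * f i) *
       (?g (circlepath 0 1 t) * circlepath 0 1 t ^ m / circlepath 0 1 t ^ (i + 2)))
       * vector_derivative (circlepath 0 1) (at t)) =
       ?g (circlepath 0 1 t) * cnj (circlepath 0 1 t) * of_real ((norm (V (circlepath 0 1 t)))\<^sup>2)"
      unfolding vd unfolding u_def[symmetric] by (simp only: cancel)
  qed simp
  from has_integral_Re[OF this]
  have "((\<lambda>t. Re (?g (circlepath 0 1 t) * cnj (circlepath 0 1 t)) * (norm (V (circlepath 0 1 t)))\<^sup>2)
       has_integral ?S) {0..1}"
    by simp
  then show ?thesis
  proof (rule has_integral_le[OF _ has_integral_0])
    fix t :: real
    have "norm (circlepath 0 1 t) = 1" by (simp add: circlepath)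
    from symbol_nonpos[OF assms(1,2) this]
    show "Re (?g (circlepath 0 1 t) * cnj (circlepath 0 1 t)) * (norm (V (circlepath 0 1 t)))\<^sup>2 \<le> 0"
      by (intro mult_nonpos_nonneg) auto
  qed
qed

section \<open>One-dimensional difference operators as quadratic forms\<close>

text \<open>The one-dimensional versions of \<open>op_Lx\<close> and \<open>op_Ly\<close> (\<open>tri\<close>) and of \<open>delta_x\<close> and
  \<open>delta_y\<close> (\<open>riesz\<close>). As there, they are applied at interior indices only.\<close>

definition tri :: "real \<Rightarrow> (nat \<Rightarrow> real) \<Rightarrow> nat \<Rightarrow> real" where
  "tri s f i = f i + s * (f (i + 1) - 2 * f i + f (i - 1))"

definition riesz_scale :: "real \<Rightarrow> real \<Rightarrow> nat \<Rightarrow> real" where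
  "riesz_scale \<gamma> L M = - 1 / (2 * cos (pi * \<gamma> / 2) * (L / real M) powr \<gamma>)"

definition riesz :: "real \<Rightarrow> real \<Rightarrow> nat \<Rightarrow> (nat \<Rightarrow> real) \<Rightarrow> nat \<Rightarrow> real" where
  "riesz \<gamma> L M f i = riesz_scale \<gamma> L M *
       ((\<Sum>l=0..i + 1. kappa2 \<gamma> l * f (i + 1 - l)) + (\<Sum>l=0..M - i + 1. kappa2 \<gamma> l * f (i + l - 1)))"

lemma sigma2_bounds:
  assumes "1 < \<gamma>" "\<gamma> < 2"
  shows "0 \<le> sigma2 \<gamma>" "4 * sigma2 \<gamma> < 1"
proof -
  have "2 * \<gamma>\<^sup>2 - 6 * \<gamma> + 3 = 2 * ((\<gamma> - 1) * (\<gamma> - 2)) - 1" by (simp add: power2_eq_square algebra_simps)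
  moreover have "(\<gamma> - 1) * (\<gamma> - 2) \<le> 0" using assms by (intro mult_nonneg_nonpos) auto
  ultimately have "2 * \<gamma>\<^sup>2 - 6 * \<gamma> + 3 \<le> 0" by linarith
  then show "0 \<le> sigma2 \<gamma>" using assms by (simp add: sigma2_def divide_nonpos_pos)
  have "4 * \<gamma>\<^sup>2 - 9 * \<gamma> + 6 = (2 * \<gamma> - 9 / 4)\<^sup>2 + 15 / 16" by (simp add: power2_eq_square algebra_simps)
  also have "\<dots> > 0" by (intro add_nonneg_pos) auto
  finally show "4 * sigma2 \<gamma> < 1" using assms by (simp add: sigma2_def field_simps)
qed

lemma sum_interior_shift:
  fixes g :: "nat \<Rightarrow> real"
  assumes "g 0 = 0" "g (M - 1) = 0"
  shows "(\<Sum>j=1..M - 1. g (j - 1)) = (\<Sum>j=1..M - 1. g j)"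
proof (cases "M \<le> 1")
  case False
  then obtain n where M: "M = Suc (Suc n)" by (metis One_nat_def Suc_diff_1 less_imp_Suc_add linorder_not_le not_less_eq not_less0)
  have "(\<Sum>j=1..Suc n. g (j - 1)) = (\<Sum>j=0..n. g j)"
    by (rule sum.reindex_bij_witness[of _ Suc "\<lambda>j. j - 1"]) auto
  also have "\<dots> = (\<Sum>j=0..Suc n. g j)" using assms by (simp add: M)
  also have "\<dots> = (\<Sum>j=1..Suc n. g j)" using assms by (simp add: sum.atLeast_Suc_atMost)
  finally show ?thesis by (simp add: M)
qed auto

lemma tri_sym:
  assumes "f 0 = 0" "f M = 0" "g 0 = 0" "g M = 0"
  shows "(\<Sum>i=1..M - 1. tri s f i * g i) = (\<Sum>i=1..M - 1. f i * tri s g i)"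
proof (cases "M = 0")
  case False
  have a: "(\<Sum>i=1..M - 1. f (i - 1) * g i) = (\<Sum>i=1..M - 1. f i * g (i + 1))"
    if "f 0 = 0" "g M = 0" for f g :: "nat \<Rightarrow> real"
  proof -
    have "(\<Sum>i=1..M - 1. f (i - 1) * g i) = (\<Sum>i=1..M - 1. f (i - 1) * g (i - 1 + 1))"
      by (intro sum.cong) auto
    also have "\<dots> = (\<Sum>i=1..M - 1. f i * g (i + 1))"
      using that False sum_interior_shift[of "\<lambda>i. f i * g (i + 1)" M] by simp
    finally show ?thesis .
  qed
  have "(\<Sum>i=1..M - 1. tri s f i * g i)
      = (1 - 2 * s) * (\<Sum>i=1..M - 1. f i * g i)
        + s * ((\<Sum>i=1..M - 1. g i * f (i + 1)) + (\<Sum>i=1..M - 1. f (i - 1) * g i))"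
    by (simp add: sum_distrib_left sum.distrib[symmetric] tri_def algebra_simps)
  also have "\<dots> = (1 - 2 * s) * (\<Sum>i=1..M - 1. f i * g i)
        + s * ((\<Sum>i=1..M - 1. g (i - 1) * f i) + (\<Sum>i=1..M - 1. f i * g (i + 1)))"
    using a[of f g] a[of g f] assms by simp
  also have "\<dots> = (\<Sum>i=1..M - 1. f i * tri s g i)"
    by (simp add: sum_distrib_left sum.distrib[symmetric] tri_def algebra_simps)
  finally show ?thesis .
qed auto

text \<open>The bounds \<open>1 - 4 * s\<close> and 1 for the matrix of \<open>tri s\<close>, tested against the Gram matrix \<open>b\<close> of
  a sequence \<open>v\<^sub>0, \<dots>, v\<^sub>M\<close> with \<open>v\<^sub>0 = v\<^sub>M = 0\<close> under a semidefinite form. The form is needed on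
  the sums \<open>v\<^sub>j + v\<^bsub>j + 1\<^esub>\<close> and differences \<open>v\<^sub>j - v\<^bsub>j + 1\<^esub>\<close> only. Scalar Gram matrices give
  \<open>tri_form_bounds\<close>, and those of the rows of a grid function give \<open>tri_tensor_bounds\<close>.\<close>

lemma tri_gram_bounds:
  fixes b :: "nat \<Rightarrow> nat \<Rightarrow> real"
  assumes s: "0 \<le> s"
    and sym: "\<And>j k. j \<le> M \<Longrightarrow> k \<le> M \<Longrightarrow> b j k = b k j"
    and bd: "\<And>k. k \<le> M \<Longrightarrow> b 0 k = 0" "\<And>k. k \<le> M \<Longrightarrow> b M k = 0"
    and pos: "\<And>j. j < M \<Longrightarrow> 0 \<le> b j j + 2 * b j (j + 1) + b (j + 1) (j + 1)"
    and neg: "\<And>j. j < M \<Longrightarrow> 0 \<le> b j j - 2 * b j (j + 1) + b (j + 1) (j + 1)"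
  shows "(1 - 4 * s) * (\<Sum>j=1..M - 1. b j j) \<le> (\<Sum>j=1..M - 1. tri s (\<lambda>k. b k j) j)"
    and "(\<Sum>j=1..M - 1. tri s (\<lambda>k. b k j) j) \<le> (\<Sum>j=1..M - 1. b j j)"
proof -
  have "(1 - 4 * s) * (\<Sum>j=1..M - 1. b j j) \<le> (\<Sum>j=1..M - 1. tri s (\<lambda>k. b k j) j)
    \<and> (\<Sum>j=1..M - 1. tri s (\<lambda>k. b k j) j) \<le> (\<Sum>j=1..M - 1. b j j)"
  proof (cases "M = 0")
    case False
    then obtain n where M: "M = Suc n" by (cases M) auto
    let ?D = "\<Sum>j=1..n. b j j"
    \<comment> \<open>each boundary term vanishes, so every shifted sum is one of these two\<close>
    let ?O = "\<Sum>j=0..n. b j (j + 1)"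
    have D0: "(\<Sum>j=0..n. b j j) = ?D" using bd by (simp add: sum.atLeast_Suc_atMost)
    have D1: "(\<Sum>j=0..n. b (j + 1) (j + 1)) = ?D"
    proof -
      have "(\<Sum>j=0..n. b (j + 1) (j + 1)) = (\<Sum>j=Suc 0..Suc n. b j j)"
        by (simp add: sum.shift_bounds_cl_Suc_ivl del: sum.cl_ivl_Suc)
      also have "\<dots> = ?D" using bd(2)[of M] by (simp add: M)
      finally show ?thesis .
    qed
    have O1: "(\<Sum>j=1..n. b (j + 1) j) = ?O"
    proof -
      have "(\<Sum>j=1..n. b (j + 1) j) = (\<Sum>j=1..n. b j (j + 1))"
        by (intro sum.cong refl sym) (auto simp: M)
      also have "\<dots> = ?O" using bd(1)[of 1] by (simp add: sum.atLeast_Suc_atMost M)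
      finally show ?thesis .
    qed
    have O2: "(\<Sum>j=1..n. b (j - 1) j) = ?O"
    proof -
      have "(\<Sum>j=1..n. b (j - 1) j) = (\<Sum>j\<in>{0..<n}. b j (j + 1))"
        by (rule sum.reindex_bij_witness[of _ Suc "\<lambda>j. j - 1"]) auto
      also have "\<dots> = ?O" using bd(2)[of n] sym[of n M]
        by (simp add: M atLeast0AtMost atLeast0LessThan lessThan_Suc_atMost[symmetric])
      finally show ?thesis .
    qed
    have "(\<Sum>j=1..n. tri s (\<lambda>k. b k j) j)
        = (1 - 2 * s) * ?D + s * ((\<Sum>j=1..n. b (j + 1) j) + (\<Sum>j=1..n. b (j - 1) j))"
      by (simp add: sum_distrib_left sum.distrib[symmetric] tri_def algebra_simps)
    then have T: "(\<Sum>j=1..n. tri s (\<lambda>k. b k j) j) = (1 - 2 * s) * ?D + 2 * s * ?O"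
      unfolding O1 O2 by simp
    have "0 \<le> (\<Sum>j=0..n. b j j + 2 * b j (j + 1) + b (j + 1) (j + 1))"
      by (intro sum_nonneg pos) (auto simp: M)
    also have "\<dots> = 2 * ?D + 2 * ?O"
      by (simp only: sum.distrib D0 D1 sum_distrib_left[symmetric])
    finally have "0 \<le> s * (?D + ?O)" using s by simp
    moreover have "0 \<le> (\<Sum>j=0..n. b j j - 2 * b j (j + 1) + b (j + 1) (j + 1))"
      by (intro sum_nonneg neg) (auto simp: M)
    then have "0 \<le> 2 * ?D - 2 * ?O"
      by (simp only: sum.distrib sum_subtractf D0 D1 sum_distrib_left[symmetric])
    then have "0 \<le> s * (?D - ?O)" using s by simp
    ultimately show ?thesis unfolding M diff_Suc_1 T by (simp add: algebra_simps)
  qed auto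
  then show "(1 - 4 * s) * (\<Sum>j=1..M - 1. b j j) \<le> (\<Sum>j=1..M - 1. tri s (\<lambda>k. b k j) j)"
    and "(\<Sum>j=1..M - 1. tri s (\<lambda>k. b k j) j) \<le> (\<Sum>j=1..M - 1. b j j)" by auto
qed

lemma tri_form_bounds:
  assumes "0 \<le> s" "f 0 = 0" "f M = 0"
  shows "(1 - 4 * s) * (\<Sum>i=1..M - 1. (f i)\<^sup>2) \<le> (\<Sum>i=1..M - 1. tri s f i * f i)"
    and "(\<Sum>i=1..M - 1. tri s f i * f i) \<le> (\<Sum>i=1..M - 1. (f i)\<^sup>2)"
proof -
  have e: "f j * f j + 2 * (f j * f (j + 1)) + f (j + 1) * f (j + 1) = (f j + f (j + 1))\<^sup>2"
    "f j * f j - 2 * (f j * f (j + 1)) + f (j + 1) * f (j + 1) = (f j - f (j + 1))\<^sup>2" for j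
    by (simp_all add: power2_eq_square algebra_simps)
  have t: "tri s (\<lambda>k. f k * f i) i = tri s f i * f i" for i by (simp add: tri_def algebra_simps)
  show "(1 - 4 * s) * (\<Sum>i=1..M - 1. (f i)\<^sup>2) \<le> (\<Sum>i=1..M - 1. tri s f i * f i)"
    using tri_gram_bounds(1)[of s M "\<lambda>j k. f j * f k"] assms
    by (simp only: e t power2_eq_square) (simp add: power2_eq_square mult.commute)
  show "(\<Sum>i=1..M - 1. tri s f i * f i) \<le> (\<Sum>i=1..M - 1. (f i)\<^sup>2)"
    using tri_gram_bounds(2)[of s M "\<lambda>j k. f j * f k"] assms
    by (simp only: e t power2_eq_square) (simp add: power2_eq_square mult.commute)
qed

lemma riesz_eq_shifted_coeff:
  assumes "f 0 = 0" "f M = 0" "1 \<le> i" "i \<le> M - 1"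
  shows "riesz \<gamma> L M f i = riesz_scale \<gamma> L M *
    (\<Sum>m=1..M - 1. (shifted_coeff \<gamma> i m + shifted_coeff \<gamma> m i) * f m)"
proof -
  have "(\<Sum>l=0..i + 1. kappa2 \<gamma> l * f (i + 1 - l)) = (\<Sum>m=0..i + 1. kappa2 \<gamma> (i + 1 - m) * f m)"
    by (rule sum.reindex_bij_witness[of _ "\<lambda>m. i + 1 - m" "\<lambda>l. i + 1 - l"]) auto
  also have "\<dots> = (\<Sum>m=0..i + 1. shifted_coeff \<gamma> i m * f m)"
    by (intro sum.cong) (auto simp: shifted_coeff_def)
  also have "\<dots> = (\<Sum>m=0..M. shifted_coeff \<gamma> i m * f m)"
    using assms by (intro sum.mono_neutral_left) (auto simp: shifted_coeff_def)
  also have "\<dots> = (\<Sum>m=1..M - 1. shifted_coeff \<gamma> i m * f m)"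
  proof (intro sum.mono_neutral_right ballI)
    fix m assume "m \<in> {0..M} - {1..M - 1}"
    then have "m = 0 \<or> m = M" by auto
    then show "shifted_coeff \<gamma> i m * f m = 0" using assms by auto
  qed auto
  finally have l: "(\<Sum>l=0..i + 1. kappa2 \<gamma> l * f (i + 1 - l)) = \<dots>" .
  have "(\<Sum>l=0..M - i + 1. kappa2 \<gamma> l * f (i + l - 1)) = (\<Sum>m=i - 1..M. kappa2 \<gamma> (m + 1 - i) * f m)"
    using assms
    by (intro sum.reindex_bij_witness[of _ "\<lambda>m. m + 1 - i" "\<lambda>l. i + l - 1"]) auto
  also have "\<dots> = (\<Sum>m=i - 1..M. shifted_coeff \<gamma> m i * f m)"
    by (intro sum.cong) (auto simp: shifted_coeff_def)
  also have "\<dots> = (\<Sum>m=0..M. shifted_coeff \<gamma> m i * f m)"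
    using assms by (intro sum.mono_neutral_left) (auto simp: shifted_coeff_def)
  also have "\<dots> = (\<Sum>m=1..M - 1. shifted_coeff \<gamma> m i * f m)"
  proof (intro sum.mono_neutral_right ballI)
    fix m assume "m \<in> {0..M} - {1..M - 1}"
    then have "m = 0 \<or> m = M" by auto
    then show "shifted_coeff \<gamma> m i * f m = 0" using assms by auto
  qed auto
  finally have r: "(\<Sum>l=0..M - i + 1. kappa2 \<gamma> l * f (i + l - 1)) = \<dots>" .
  show ?thesis unfolding riesz_def l r by (simp only: sum.distrib[symmetric] distrib_right)
qed

lemma riesz_sym:
  assumes "f 0 = 0" "f M = 0" "g 0 = 0" "g M = 0"
  shows "(\<Sum>i=1..M - 1. riesz \<gamma> L M f i * g i) = (\<Sum>i=1..M - 1. riesz \<gamma> L M g i * f i)"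
proof -
  define c where "c = riesz_scale \<gamma> L M"
  have e: "(\<Sum>i=1..M - 1. riesz \<gamma> L M f i * g i) =
     c * (\<Sum>i=1..M - 1. \<Sum>m=1..M - 1. (shifted_coeff \<gamma> i m + shifted_coeff \<gamma> m i) * f m * g i)"
    if "f 0 = 0" "f M = 0" for f g
    using that
    by (simp add: riesz_eq_shifted_coeff[OF that] c_def[symmetric]
        sum_distrib_left sum_distrib_right mult_ac)
  show ?thesis
    unfolding e[OF assms(1,2)] e[OF assms(3,4)]
    by (subst sum.swap) (simp only: mult_ac add.commute)
qed

text \<open>The scale is nonnegative because \<open>cos (\<pi> \<gamma> / 2) < 0\<close> for \<open>1 < \<gamma> < 2\<close>; the left- and
  right-sided sums contribute equally.\<close>

lemma riesz_form_nonpos: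
  assumes "1 < \<gamma>" "\<gamma> < 2" "f 0 = 0" "f M = 0"
  shows "(\<Sum>i=1..M - 1. riesz \<gamma> L M f i * f i) \<le> 0"
proof -
  define c where "c = riesz_scale \<gamma> L M"
  let ?Q = "\<Sum>i=1..M - 1. \<Sum>m=1..M - 1. shifted_coeff \<gamma> i m * f m * f i"
  have "cos (pi * \<gamma> / 2) = - cos (pi - pi * \<gamma> / 2)" by simp
  moreover have "pi * 1 < pi * \<gamma>" "pi * \<gamma> < pi * 2"
    using assms by (simp_all only: mult_less_cancel_left_pos[OF pi_gt_zero])
  then have "cos (pi - pi * \<gamma> / 2) > 0" by (intro cos_gt_zero_pi) linarith+
  ultimately have "cos (pi * \<gamma> / 2) \<le> 0" by simp
  then have "2 * cos (pi * \<gamma> / 2) \<le> 0" by simp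
  from mult_nonpos_nonneg[OF this powr_ge_zero]
  have "2 * cos (pi * \<gamma> / 2) * (L / real M) powr \<gamma> \<le> 0" .
  then have c: "c \<ge> 0" unfolding c_def riesz_scale_def by (intro divide_nonpos_nonpos) auto
  have "(\<Sum>i=1..M - 1. riesz \<gamma> L M f i * f i) =
     c * (\<Sum>i=1..M - 1. \<Sum>m=1..M - 1. (shifted_coeff \<gamma> i m + shifted_coeff \<gamma> m i) * f m * f i)"
    by (simp add: riesz_eq_shifted_coeff[OF assms(3,4)] c_def[symmetric]
        sum_distrib_left sum_distrib_right mult_ac)
  also have "\<dots> = c * (?Q + (\<Sum>i=1..M - 1. \<Sum>m=1..M - 1. shifted_coeff \<gamma> m i * f m * f i))"
    by (simp only: sum.distrib[symmetric] distrib_right)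
  also have "(\<Sum>i=1..M - 1. \<Sum>m=1..M - 1. shifted_coeff \<gamma> m i * f m * f i) = ?Q"
    by (subst sum.swap) (simp add: mult_ac)
  also have "c * (?Q + ?Q) \<le> 0"
    using c shifted_coeff_form_nonpos[OF assms(1,2), of "{1..M - 1}" f] by (simp add: mult_le_0_iff)
  finally show ?thesis .
qed

section \<open>Grid functions and the energy\<close>

text \<open>If \<open>A\<close> is a positive semidefinite operator in the first variable, then \<open>tri s\<close> in the second
  variable changes its quadratic form by a factor between \<open>1 - 4 * s\<close> and 1.\<close>

lemma tri_tensor_bounds:
  fixes A :: "(nat \<Rightarrow> real) \<Rightarrow> nat \<Rightarrow> real" and w :: "nat \<Rightarrow> nat \<Rightarrow> real"
  assumes s: "0 \<le> s"
    and lin: "\<And>f g c i. A (\<lambda>i. f i + c * g i) i = A f i + c * A g i"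
    and sym: "\<And>f g. f 0 = 0 \<Longrightarrow> f M = 0 \<Longrightarrow> g 0 = 0 \<Longrightarrow> g M = 0 \<Longrightarrow>
      (\<Sum>i=1..M - 1. A f i * g i) = (\<Sum>i=1..M - 1. A g i * f i)"
    and nonneg: "\<And>f. f 0 = 0 \<Longrightarrow> f M = 0 \<Longrightarrow> 0 \<le> (\<Sum>i=1..M - 1. A f i * f i)"
    and bdx: "\<And>j. j \<le> K \<Longrightarrow> w 0 j = 0" "\<And>j. j \<le> K \<Longrightarrow> w M j = 0"
    and bdy: "\<And>i. i \<le> M \<Longrightarrow> w i 0 = 0" "\<And>i. i \<le> M \<Longrightarrow> w i K = 0"
  shows "(1 - 4 * s) * (\<Sum>i=1..M - 1. \<Sum>j=1..K - 1. A (\<lambda>i. w i j) i * w i j)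
      \<le> (\<Sum>i=1..M - 1. \<Sum>j=1..K - 1. tri s (\<lambda>j. A (\<lambda>i. w i j) i) j * w i j)"
    and "(\<Sum>i=1..M - 1. \<Sum>j=1..K - 1. tri s (\<lambda>j. A (\<lambda>i. w i j) i) j * w i j)
      \<le> (\<Sum>i=1..M - 1. \<Sum>j=1..K - 1. A (\<lambda>i. w i j) i * w i j)"
proof -
  define b where "b j k = (\<Sum>i=1..M - 1. A (\<lambda>i. w i j) i * w i k)" for j k
  have diag: "(\<Sum>i=1..M - 1. \<Sum>j=1..K - 1. A (\<lambda>i. w i j) i * w i j) = (\<Sum>j=1..K - 1. b j j)"
    unfolding b_def by (rule sum.swap)
  have form: "(\<Sum>i=1..M - 1. \<Sum>j=1..K - 1. tri s (\<lambda>j. A (\<lambda>i. w i j) i) j * w i j)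
      = (\<Sum>j=1..K - 1. tri s (\<lambda>k. b k j) j)"
    unfolding b_def tri_def
    by (subst sum.swap) (simp add: sum_distrib_left sum.distrib sum_subtractf algebra_simps)
  have bsym: "b j k = b k j" if "j \<le> K" "k \<le> K" for j k
    unfolding b_def using that bdx by (intro sym) auto
  have bd: "b 0 k = 0" "b K k = 0" if "k \<le> K" for k
  proof -
    have "b k 0 = 0" "b k K = 0" using bdy by (auto simp: b_def intro!: sum.neutral)
    then show "b 0 k = 0" "b K k = 0" using bsym that by auto
  qed
  have comb: "b j j + 2 * c * b j (j + 1) + c\<^sup>2 * b (j + 1) (j + 1) \<ge> 0" if "j < K" for j c
  proof -
    have "0 \<le> (\<Sum>i=1..M - 1. A (\<lambda>i. w i j + c * w i (j + 1)) i * (w i j + c * w i (j + 1)))"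
      using that bdx by (intro nonneg) auto
    also have "\<dots> = b j j + c * b j (j + 1) + c * b (j + 1) j + c\<^sup>2 * b (j + 1) (j + 1)"
      unfolding lin[of "\<lambda>i. w i j" c "\<lambda>i. w i (j + 1)"] b_def
      by (simp add: sum_distrib_left sum.distrib algebra_simps power2_eq_square)
    also have "b (j + 1) j = b j (j + 1)" using that by (intro bsym) auto
    finally show ?thesis by simp
  qed
  have plus: "0 \<le> b j j + 2 * b j (j + 1) + b (j + 1) (j + 1)" if "j < K" for j
    using comb[OF that, of 1] by simp
  have minus: "0 \<le> b j j - 2 * b j (j + 1) + b (j + 1) (j + 1)" if "j < K" for j
    using comb[OF that, of "- 1"] by simp
  note gram = tri_gram_bounds[of s K b, OF s bsym bd plus minus]
  show "(1 - 4 * s) * (\<Sum>i=1..M - 1. \<Sum>j=1..K - 1. A (\<lambda>i. w i j) i * w i j)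
      \<le> (\<Sum>i=1..M - 1. \<Sum>j=1..K - 1. tri s (\<lambda>j. A (\<lambda>i. w i j) i) j * w i j)"
    unfolding diag form by (rule gram(1))
  show "(\<Sum>i=1..M - 1. \<Sum>j=1..K - 1. tri s (\<lambda>j. A (\<lambda>i. w i j) i) j * w i j)
      \<le> (\<Sum>i=1..M - 1. \<Sum>j=1..K - 1. A (\<lambda>i. w i j) i * w i j)"
    unfolding diag form by (rule gram(2))
qed

text \<open>Index form of \<open>grid_space\<close>.\<close>

definition zero_boundary :: "nat \<Rightarrow> nat \<Rightarrow> gridfun \<Rightarrow> bool" where
  "zero_boundary M K w \<longleftrightarrow> (\<forall>i\<le>M. \<forall>j\<le>K. i = 0 \<or> i = M \<or> j = 0 \<or> j = K \<longrightarrow> w i j = 0)"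

lemma zero_boundaryD:
  assumes "zero_boundary M K w"
  shows "j \<le> K \<Longrightarrow> w 0 j = 0" "j \<le> K \<Longrightarrow> w M j = 0"
    and "i \<le> M \<Longrightarrow> w i 0 = 0" "i \<le> M \<Longrightarrow> w i K = 0"
  using assms by (auto simp: zero_boundary_def)

text \<open>The discrete inner product without the factor \<open>h\<^sub>a h\<^sub>b\<close>.\<close>

definition interior_sum :: "nat \<Rightarrow> nat \<Rightarrow> gridfun \<Rightarrow> gridfun \<Rightarrow> real" where
  "interior_sum M K a b = (\<Sum>i=1..M - 1. \<Sum>j=1..K - 1. a i j * b i j)"

lemma op_Lx_eq_tri: "op_Lx \<alpha> w i j = tri (sigma2 \<alpha>) (\<lambda>i. w i j) i"
  by (simp add: op_Lx_def tri_def)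

lemma op_Ly_eq_tri: "op_Ly \<beta> w i j = tri (sigma2 \<beta>) (w i) j"
  by (simp add: op_Ly_def tri_def)

lemma delta_x_eq_riesz: "delta_x \<alpha> L M w i j = riesz \<alpha> L M (\<lambda>i. w i j) i"
  by (simp add: delta_x_def riesz_def riesz_scale_def)

lemma delta_y_eq_riesz: "delta_y \<beta> L M w i j = riesz \<beta> L M (w i) j"
  by (simp add: delta_y_def riesz_def riesz_scale_def)

lemma op_Lx_Ly_commute: "op_Lx \<alpha> (op_Ly \<beta> w) i j = op_Ly \<beta> (op_Lx \<alpha> w) i j"
  by (simp add: op_Lx_def op_Ly_def algebra_simps)

text \<open>With the roles of the two variables exchanged, this also covers the fractional difference in
  the second variable.\<close>

lemma riesz_tensor_nonpos:
  fixes w :: "nat \<Rightarrow> nat \<Rightarrow> real"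
  assumes "1 < \<gamma>" "\<gamma> < 2" "1 < \<gamma>'" "\<gamma>' < 2" and w: "zero_boundary M K w"
  shows "(\<Sum>i=1..M - 1. \<Sum>j=1..K - 1. tri (sigma2 \<gamma>') (\<lambda>j. riesz \<gamma> L M (\<lambda>i. w i j) i) j * w i j) \<le> 0"
proof -
  let ?A = "\<lambda>f i. - riesz \<gamma> L M f i"
  have nonneg: "0 \<le> (\<Sum>i=1..M - 1. ?A f i * f i)" if "f 0 = 0" "f M = 0" for f
    using riesz_form_nonpos[OF assms(1,2) that, of L] by (simp add: sum_negf)
  have "0 \<le> (1 - 4 * sigma2 \<gamma>') * (\<Sum>i=1..M - 1. \<Sum>j=1..K - 1. ?A (\<lambda>i. w i j) i * w i j)"
  proof (intro mult_nonneg_nonneg)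
    show "0 \<le> (\<Sum>i=1..M - 1. \<Sum>j=1..K - 1. ?A (\<lambda>i. w i j) i * w i j)"
      using w by (subst sum.swap, intro sum_nonneg nonneg) (auto simp: zero_boundary_def)
  qed (use sigma2_bounds[OF assms(3,4)] in simp)
  also have "\<dots> \<le> (\<Sum>i=1..M - 1. \<Sum>j=1..K - 1. tri (sigma2 \<gamma>') (\<lambda>j. ?A (\<lambda>i. w i j) i) j * w i j)"
  proof (rule tri_tensor_bounds(1)[where A = ?A])
    show "?A (\<lambda>i. f i + c * g i) i = ?A f i + c * ?A g i" for f g c i
      by (simp add: riesz_def sum.distrib sum_distrib_left algebra_simps)
    show "(\<Sum>i=1..M - 1. ?A f i * g i) = (\<Sum>i=1..M - 1. ?A g i * f i)"
      if "f 0 = 0" "f M = 0" "g 0 = 0" "g M = 0" for f g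
      using riesz_sym[OF that, of \<gamma> L] by (simp add: sum_negf)
  qed (use w sigma2_bounds[OF assms(3,4)] nonneg in \<open>auto simp: zero_boundary_def\<close>)
  also have "\<dots> = - (\<Sum>i=1..M - 1. \<Sum>j=1..K - 1. tri (sigma2 \<gamma>') (\<lambda>j. riesz \<gamma> L M (\<lambda>i. w i j) i) j * w i j)"
    by (simp add: sum_negf[symmetric] tri_def algebra_simps)
  finally show ?thesis by simp
qed

lemma interior_sum_op_Ly_delta_x_nonpos:
  assumes "1 < \<alpha>" "\<alpha> < 2" "1 < \<beta>" "\<beta> < 2" "zero_boundary M K w"
  shows "interior_sum M K (op_Ly \<beta> (delta_x \<alpha> L M w)) w \<le> 0"
  using riesz_tensor_nonpos[OF assms]
  by (simp add: interior_sum_def op_Ly_eq_tri delta_x_eq_riesz[abs_def])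

lemma interior_sum_op_Lx_delta_y_nonpos:
  assumes "1 < \<alpha>" "\<alpha> < 2" "1 < \<beta>" "\<beta> < 2" "zero_boundary M K w"
  shows "interior_sum M K (op_Lx \<alpha> (delta_y \<beta> L K w)) w \<le> 0"
proof -
  have "zero_boundary K M (\<lambda>j i. w i j)" using assms(5) by (auto simp: zero_boundary_def)
  from riesz_tensor_nonpos[OF assms(3,4,1,2) this, of L] show ?thesis
    unfolding interior_sum_def by (subst sum.swap) (simp add: op_Lx_eq_tri delta_y_eq_riesz)
qed

text \<open>The energy \<open>(L\<^sub>x L\<^sub>y w, w)\<close> is equivalent to the squared norm, uniformly in the mesh.\<close>

lemma energy_bounds:
  assumes "1 < \<alpha>" "\<alpha> < 2" "1 < \<beta>" "\<beta> < 2" "zero_boundary M K w"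
  shows "(1 - 4 * sigma2 \<alpha>) * (1 - 4 * sigma2 \<beta>) * interior_sum M K w w
      \<le> interior_sum M K (op_Lx \<alpha> (op_Ly \<beta> w)) w"
    and "interior_sum M K (op_Lx \<alpha> (op_Ly \<beta> w)) w \<le> interior_sum M K w w"
proof -
  let ?s = "sigma2 \<alpha>" and ?t = "sigma2 \<beta>"
  note bnds = sigma2_bounds[OF assms(1,2)] sigma2_bounds[OF assms(3,4)]
  let ?X = "\<Sum>i=1..M - 1. \<Sum>j=1..K - 1. tri ?s (\<lambda>i. w i j) i * w i j"
  have E: "interior_sum M K (op_Lx \<alpha> (op_Ly \<beta> w)) w
      = (\<Sum>i=1..M - 1. \<Sum>j=1..K - 1. tri ?t (\<lambda>j. tri ?s (\<lambda>i. w i j) i) j * w i j)"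
    unfolding interior_sum_def op_Lx_Ly_commute op_Ly_eq_tri by (simp add: op_Lx_eq_tri[abs_def])
  have lin: "tri ?s (\<lambda>i. f i + c * g i) i = tri ?s f i + c * tri ?s g i" for f g c i
    by (simp add: tri_def algebra_simps)
  have sym: "(\<Sum>i=1..M - 1. tri ?s f i * g i) = (\<Sum>i=1..M - 1. tri ?s g i * f i)"
    if "f 0 = 0" "f M = 0" "g 0 = 0" "g M = 0" for f g
    using tri_sym[OF that, of ?s] by (simp add: mult.commute)
  have nonneg: "0 \<le> (\<Sum>i=1..M - 1. tri ?s f i * f i)" if "f 0 = 0" "f M = 0" for f
    using bnds by (intro order_trans[OF _ tri_form_bounds(1)] that mult_nonneg_nonneg sum_nonneg) auto
  note bd = zero_boundaryD[OF assms(5)]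
  note tensor = tri_tensor_bounds[where A = "tri ?s" and s = ?t and w = w and M = M and K = K,
      OF bnds(3) lin sym nonneg bd, folded E]
  have W: "interior_sum M K w w = (\<Sum>j=1..K - 1. \<Sum>i=1..M - 1. (w i j)\<^sup>2)"
    unfolding interior_sum_def power2_eq_square by (rule sum.swap)
  have X: "?X = (\<Sum>j=1..K - 1. \<Sum>i=1..M - 1. tri ?s (\<lambda>i. w i j) i * w i j)"
    by (rule sum.swap)
  have low: "(1 - 4 * ?s) * interior_sum M K w w \<le> ?X"
    unfolding W X sum_distrib_left[of _ _ "{1..K - 1}"]
    using bnds bd by (intro sum_mono[of "{1..K - 1}"] tri_form_bounds(1)) auto
  have up: "?X \<le> interior_sum M K w w"
    unfolding W X
    using bnds bd by (intro sum_mono[of "{1..K - 1}"] tri_form_bounds(2)) auto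
  have "(1 - 4 * ?t) * ((1 - 4 * ?s) * interior_sum M K w w) \<le> (1 - 4 * ?t) * ?X"
    using low bnds by (intro mult_left_mono) auto
  also have "\<dots> \<le> interior_sum M K (op_Lx \<alpha> (op_Ly \<beta> w)) w" by (rule tensor(1))
  finally show "(1 - 4 * ?s) * (1 - 4 * ?t) * interior_sum M K w w
      \<le> interior_sum M K (op_Lx \<alpha> (op_Ly \<beta> w)) w" by (simp only: mult_ac)
  show "interior_sum M K (op_Lx \<alpha> (op_Ly \<beta> w)) w \<le> interior_sum M K w w"
    using tensor(2) up by (rule order_trans)
qed

lemma energy_sym:
  assumes "zero_boundary M K a" "zero_boundary M K b"
  shows "interior_sum M K (op_Lx \<alpha> (op_Ly \<beta> a)) b = interior_sum M K (op_Lx \<alpha> (op_Ly \<beta> b)) a"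
proof -
  have "interior_sum M K (op_Lx \<alpha> (op_Ly \<beta> a)) b
      = (\<Sum>j=1..K - 1. \<Sum>i=1..M - 1. tri (sigma2 \<alpha>) (\<lambda>i. op_Ly \<beta> a i j) i * b i j)"
    unfolding interior_sum_def op_Lx_eq_tri by (rule sum.swap)
  also have "\<dots> = (\<Sum>j=1..K - 1. \<Sum>i=1..M - 1. op_Ly \<beta> a i j * tri (sigma2 \<alpha>) (\<lambda>i. b i j) i)"
    using assms
    by (intro sum.cong[OF refl, of "{1..K - 1}"] tri_sym) (auto simp: op_Ly_def zero_boundaryD)
  also have "\<dots> = (\<Sum>i=1..M - 1. \<Sum>j=1..K - 1. tri (sigma2 \<beta>) (a i) j * op_Lx \<alpha> b i j)"
    unfolding op_Ly_eq_tri op_Lx_eq_tri by (rule sum.swap)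
  also have "\<dots> = (\<Sum>i=1..M - 1. \<Sum>j=1..K - 1. a i j * tri (sigma2 \<beta>) (op_Lx \<alpha> b i) j)"
    using assms
    by (intro sum.cong[OF refl, of "{1..M - 1}"] tri_sym) (auto simp: op_Lx_def zero_boundaryD)
  also have "\<dots> = interior_sum M K (op_Lx \<alpha> (op_Ly \<beta> b)) a"
    by (simp add: interior_sum_def op_Lx_Ly_commute op_Ly_eq_tri mult.commute)
  finally show ?thesis .
qed

text \<open>Testing the time difference with the midpoint value telescopes, by symmetry of the energy form.\<close>

lemma energy_difference:
  assumes "zero_boundary M K (w k)" "zero_boundary M K (w (k + 1))"
  shows "interior_sum M K (op_Lx \<alpha> (op_Ly \<beta> (delta_t T N w k))) (midpoint_t w k)
     = (interior_sum M K (op_Lx \<alpha> (op_Ly \<beta> (w (k + 1)))) (w (k + 1))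
        - interior_sum M K (op_Lx \<alpha> (op_Ly \<beta> (w k))) (w k)) / (2 * (T / real N))"
proof -
  let ?L = "\<lambda>a. op_Lx \<alpha> (op_Ly \<beta> a)" and ?S = "interior_sum M K"
  have "?L (delta_t T N w k) i j = (?L (w (k + 1)) i j - ?L (w k) i j) / (T / real N)" for i j
    unfolding op_Lx_def op_Ly_def delta_t_def diff_divide_distrib by algebra
  then have "?S (?L (delta_t T N w k)) (midpoint_t w k)
     = (\<Sum>i=1..M - 1. \<Sum>j=1..K - 1.
        (?L (w (k + 1)) i j * w (k + 1) i j + ?L (w (k + 1)) i j * w k i j
         - ?L (w k) i j * w (k + 1) i j - ?L (w k) i j * w k i j) / (2 * (T / real N)))"
    unfolding interior_sum_def by (intro sum.cong refl) (simp add: midpoint_t_def field_simps)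
  also have "\<dots> = (?S (?L (w (k + 1))) (w (k + 1)) + ?S (?L (w (k + 1))) (w k)
       - ?S (?L (w k)) (w (k + 1)) - ?S (?L (w k)) (w k)) / (2 * (T / real N))"
    unfolding interior_sum_def sum.distrib sum_subtractf sum_divide_distrib[symmetric] ..
  also have "?S (?L (w (k + 1))) (w k) = ?S (?L (w k)) (w (k + 1))"
    using assms by (intro energy_sym)
  finally show ?thesis by simp
qed

text \<open>The source term cancels in the difference of two solutions, which solves the homogeneous scheme.\<close>

lemma scheme_difference:
  assumes "fd_solution \<alpha> \<beta> K\<^sub>\<alpha> K\<^sub>\<beta> L\<^sub>a L\<^sub>b T f M K N a0 u"
    and "fd_solution \<alpha> \<beta> K\<^sub>\<alpha> K\<^sub>\<beta> L\<^sub>a L\<^sub>b T f M K N b0 v"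
    and "i \<in> {1..M - 1}" "j \<in> {1..K - 1}" "k < N"
  defines "w \<equiv> \<lambda>k i j. v k i j - u k i j"
  shows "op_Lx \<alpha> (op_Ly \<beta> (delta_t T N w k)) i j =
          - op_Lx \<alpha> (op_Ly \<beta> (midpoint_t w k)) i j
          + K\<^sub>\<alpha> * op_Ly \<beta> (delta_x \<alpha> L\<^sub>a M (midpoint_t w k)) i j
          + K\<^sub>\<beta> * op_Lx \<alpha> (delta_y \<beta> L\<^sub>b K (midpoint_t w k)) i j"
proof -
  have t: "delta_t T N w k = (\<lambda>i j. delta_t T N v k i j - delta_t T N u k i j)"
    "midpoint_t w k = (\<lambda>i j. midpoint_t v k i j - midpoint_t u k i j)"
    by (simp_all add: fun_eq_iff delta_t_def midpoint_t_def w_def diff_divide_distrib add_divide_distrib left_diff_distrib)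
  have L: "op_Lx \<alpha> (\<lambda>i j. a i j - b i j) = (\<lambda>i j. op_Lx \<alpha> a i j - op_Lx \<alpha> b i j)"
    "op_Ly \<beta> (\<lambda>i j. a i j - b i j) = (\<lambda>i j. op_Ly \<beta> a i j - op_Ly \<beta> b i j)" for a b
    by (simp_all add: fun_eq_iff op_Lx_def op_Ly_def algebra_simps)
  have rz: "riesz \<gamma> L m (\<lambda>i. p i - q i) l = riesz \<gamma> L m p l - riesz \<gamma> L m q l" for \<gamma> L m p q l
    unfolding riesz_def right_diff_distrib sum_subtractf by algebra
  have d: "delta_x \<alpha> L\<^sub>a M (\<lambda>i j. a i j - b i j) = (\<lambda>i j. delta_x \<alpha> L\<^sub>a M a i j - delta_x \<alpha> L\<^sub>a M b i j)"
    "delta_y \<beta> L\<^sub>b K (\<lambda>i j. a i j - b i j) = (\<lambda>i j. delta_y \<beta> L\<^sub>b K a i j - delta_y \<beta> L\<^sub>b K b i j)" for a b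
    by (simp_all add: fun_eq_iff delta_x_eq_riesz delta_y_eq_riesz rz)
  have ij: "1 \<le> i \<and> i \<le> M - 1 \<and> 1 \<le> j \<and> j \<le> K - 1 \<and> k \<le> N - 1" using assms(3-5) by auto
  from assms(1) ij have "op_Lx \<alpha> (op_Ly \<beta> (delta_t T N u k)) i j =
          - op_Lx \<alpha> (op_Ly \<beta> (midpoint_t u k)) i j
          + K\<^sub>\<alpha> * op_Ly \<beta> (delta_x \<alpha> L\<^sub>a M (midpoint_t u k)) i j
          + K\<^sub>\<beta> * op_Lx \<alpha> (delta_y \<beta> L\<^sub>b K (midpoint_t u k)) i j
          + op_Lx \<alpha> (op_Ly \<beta> (\<lambda>i j. f (node L\<^sub>a M i) (node L\<^sub>b K j) (half_time T N k))) i j"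
    unfolding fd_solution_def by blast
  moreover from assms(2) ij have "op_Lx \<alpha> (op_Ly \<beta> (delta_t T N v k)) i j =
          - op_Lx \<alpha> (op_Ly \<beta> (midpoint_t v k)) i j
          + K\<^sub>\<alpha> * op_Ly \<beta> (delta_x \<alpha> L\<^sub>a M (midpoint_t v k)) i j
          + K\<^sub>\<beta> * op_Lx \<alpha> (delta_y \<beta> L\<^sub>b K (midpoint_t v k)) i j
          + op_Lx \<alpha> (op_Ly \<beta> (\<lambda>i j. f (node L\<^sub>a M i) (node L\<^sub>b K j) (half_time T N k))) i j"
    unfolding fd_solution_def by blast
  ultimately show ?thesis by (simp add: t L d right_diff_distrib)
qed

lemma energy_step:
  assumes "1 < \<alpha>" "\<alpha> < 2" "1 < \<beta>" "\<beta> < 2" "K\<^sub>\<alpha> \<ge> 0" "K\<^sub>\<beta> \<ge> 0" "T > 0" "N > 0"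
    and bd: "zero_boundary M K (w k)" "zero_boundary M K (w (k + 1))"
    and scheme: "\<And>i j. i \<in> {1..M - 1} \<Longrightarrow> j \<in> {1..K - 1} \<Longrightarrow>
        op_Lx \<alpha> (op_Ly \<beta> (delta_t T N w k)) i j =
          - op_Lx \<alpha> (op_Ly \<beta> (midpoint_t w k)) i j
          + K\<^sub>\<alpha> * op_Ly \<beta> (delta_x \<alpha> L\<^sub>a M (midpoint_t w k)) i j
          + K\<^sub>\<beta> * op_Lx \<alpha> (delta_y \<beta> L\<^sub>b K (midpoint_t w k)) i j"
  shows "interior_sum M K (op_Lx \<alpha> (op_Ly \<beta> (w (k + 1)))) (w (k + 1))
      \<le> interior_sum M K (op_Lx \<alpha> (op_Ly \<beta> (w k))) (w k)"
proof -
  let ?S = "interior_sum M K"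
  define m where "m = midpoint_t w k"
  have m: "zero_boundary M K m" using bd by (auto simp: zero_boundary_def m_def midpoint_t_def)
  have "?S m m \<ge> 0" unfolding interior_sum_def by (intro sum_nonneg) auto
  then have "(1 - 4 * sigma2 \<alpha>) * (1 - 4 * sigma2 \<beta>) * ?S m m \<ge> 0"
    using sigma2_bounds[OF assms(1,2)] sigma2_bounds[OF assms(3,4)]
    by (intro mult_nonneg_nonneg) auto
  also have "\<dots> \<le> ?S (op_Lx \<alpha> (op_Ly \<beta> m)) m" using energy_bounds(1)[OF assms(1-4) m] .
  finally have E: "?S (op_Lx \<alpha> (op_Ly \<beta> m)) m \<ge> 0" .
  have "?S (op_Lx \<alpha> (op_Ly \<beta> (delta_t T N w k))) m
      = (\<Sum>i=1..M - 1. \<Sum>j=1..K - 1. - (op_Lx \<alpha> (op_Ly \<beta> m) i j * m i j)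
          + K\<^sub>\<alpha> * (op_Ly \<beta> (delta_x \<alpha> L\<^sub>a M m) i j * m i j)
          + K\<^sub>\<beta> * (op_Lx \<alpha> (delta_y \<beta> L\<^sub>b K m) i j * m i j))"
    unfolding interior_sum_def
    by (intro sum.cong refl) (simp add: scheme m_def[symmetric] algebra_simps)
  also have "\<dots> = - ?S (op_Lx \<alpha> (op_Ly \<beta> m)) m
          + K\<^sub>\<alpha> * ?S (op_Ly \<beta> (delta_x \<alpha> L\<^sub>a M m)) m
          + K\<^sub>\<beta> * ?S (op_Lx \<alpha> (delta_y \<beta> L\<^sub>b K m)) m"
    unfolding interior_sum_def sum.distrib sum_negf sum_distrib_left[symmetric] ..
  also have "\<dots> \<le> 0"
    using E mult_nonneg_nonpos[OF assms(5) interior_sum_op_Ly_delta_x_nonpos[OF assms(1-4) m, of L\<^sub>a]]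
      mult_nonneg_nonpos[OF assms(6) interior_sum_op_Lx_delta_y_nonpos[OF assms(1-4) m, of L\<^sub>b]]
    by linarith
  finally have "?S (op_Lx \<alpha> (op_Ly \<beta> (delta_t T N w k))) m \<le> 0" .
  moreover have "2 * (T / real N) > 0" using assms by simp
  ultimately show ?thesis
    unfolding m_def energy_difference[OF bd] by (simp only: divide_le_0_iff) linarith
qed

lemma grid_norm_eq: "grid_norm L\<^sub>a L\<^sub>b M K w = sqrt (L\<^sub>a / real M * (L\<^sub>b / real K) * interior_sum M K w w)"
  by (simp add: grid_norm_def grid_inner_def interior_sum_def)

theorem theorem5p8:
  fixes \<alpha> \<beta> K\<^sub>\<alpha> K\<^sub>\<beta> L\<^sub>a L\<^sub>b T :: real
    and f :: "real \<Rightarrow> real \<Rightarrow> real \<Rightarrow> real"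
    and u0 :: "real \<Rightarrow> real \<Rightarrow> real"
  assumes "1 < \<alpha>" and "\<alpha> < 2" and "1 < \<beta>" and "\<beta> < 2"
    and "K\<^sub>\<alpha> > 0" and "K\<^sub>\<beta> > 0" and "L\<^sub>a > 0" and "L\<^sub>b > 0" and "T > 0"
  shows "\<exists>C>0. \<forall>M\<^sub>a M\<^sub>b N. M\<^sub>a > 0 \<and> M\<^sub>b > 0 \<and> N > 0 \<longrightarrow>
    (\<forall>u v \<epsilon>. \<epsilon> \<in> grid_space L\<^sub>a L\<^sub>b M\<^sub>a M\<^sub>b
       \<and> fd_solution \<alpha> \<beta> K\<^sub>\<alpha> K\<^sub>\<beta> L\<^sub>a L\<^sub>b T f M\<^sub>a M\<^sub>b N
           (\<lambda>i j. u0 (node L\<^sub>a M\<^sub>a i) (node L\<^sub>b M\<^sub>b j)) u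
       \<and> fd_solution \<alpha> \<beta> K\<^sub>\<alpha> K\<^sub>\<beta> L\<^sub>a L\<^sub>b T f M\<^sub>a M\<^sub>b N
           (\<lambda>i j. u0 (node L\<^sub>a M\<^sub>a i) (node L\<^sub>b M\<^sub>b j) + \<epsilon> i j) v
       \<longrightarrow> (\<forall>k\<le>N. grid_norm L\<^sub>a L\<^sub>b M\<^sub>a M\<^sub>b (\<lambda>i j. v k i j - u k i j)
                    \<le> C * grid_norm L\<^sub>a L\<^sub>b M\<^sub>a M\<^sub>b \<epsilon>))"
proof -
  define D where "D = (1 - 4 * sigma2 \<alpha>) * (1 - 4 * sigma2 \<beta>)"
  have D: "D > 0" unfolding D_def
    using sigma2_bounds[OF assms(1,2)] sigma2_bounds[OF assms(3,4)] by (intro mult_pos_pos) auto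
  show ?thesis
  proof (intro exI[of _ "1 / sqrt D"] conjI allI impI)
    fix M\<^sub>a M\<^sub>b N :: nat and u v :: "nat \<Rightarrow> gridfun" and \<epsilon> :: gridfun and k :: nat
    assume pos: "M\<^sub>a > 0 \<and> M\<^sub>b > 0 \<and> N > 0" and k: "k \<le> N"
    assume H: "\<epsilon> \<in> grid_space L\<^sub>a L\<^sub>b M\<^sub>a M\<^sub>b
       \<and> fd_solution \<alpha> \<beta> K\<^sub>\<alpha> K\<^sub>\<beta> L\<^sub>a L\<^sub>b T f M\<^sub>a M\<^sub>b N
           (\<lambda>i j. u0 (node L\<^sub>a M\<^sub>a i) (node L\<^sub>b M\<^sub>b j)) u
       \<and> fd_solution \<alpha> \<beta> K\<^sub>\<alpha> K\<^sub>\<beta> L\<^sub>a L\<^sub>b T f M\<^sub>a M\<^sub>b N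
           (\<lambda>i j. u0 (node L\<^sub>a M\<^sub>a i) (node L\<^sub>b M\<^sub>b j) + \<epsilon> i j) v"
    then have u: "fd_solution \<alpha> \<beta> K\<^sub>\<alpha> K\<^sub>\<beta> L\<^sub>a L\<^sub>b T f M\<^sub>a M\<^sub>b N
           (\<lambda>i j. u0 (node L\<^sub>a M\<^sub>a i) (node L\<^sub>b M\<^sub>b j)) u"
      and v: "fd_solution \<alpha> \<beta> K\<^sub>\<alpha> K\<^sub>\<beta> L\<^sub>a L\<^sub>b T f M\<^sub>a M\<^sub>b N
           (\<lambda>i j. u0 (node L\<^sub>a M\<^sub>a i) (node L\<^sub>b M\<^sub>b j) + \<epsilon> i j) v" by blast+
    define w where "w = (\<lambda>k i j. v k i j - u k i j)"
    let ?S = "interior_sum M\<^sub>a M\<^sub>b"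
    let ?E = "\<lambda>k. ?S (op_Lx \<alpha> (op_Ly \<beta> (w k))) (w k)"
    have bdry: "(node L\<^sub>a M\<^sub>a i, node L\<^sub>b M\<^sub>b j) \<in> grid_boundary L\<^sub>a L\<^sub>b M\<^sub>a M\<^sub>b
        \<longleftrightarrow> i = 0 \<or> i = M\<^sub>a \<or> j = 0 \<or> j = M\<^sub>b" if "i \<le> M\<^sub>a" "j \<le> M\<^sub>b" for i j
      using pos assms that by (intro grid_boundary_iff) auto
    have w0: "w 0 i j = \<epsilon> i j" if "i \<le> M\<^sub>a" "j \<le> M\<^sub>b" for i j
      using u v that by (simp add: fd_solution_def w_def)
    have zero: "zero_boundary M\<^sub>a M\<^sub>b (w n)" if "n \<le> N" for n
    proof (cases "n = 0")
      case True
      then show ?thesis using H bdry w0 by (auto simp: zero_boundary_def grid_space_def)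
    next
      case False
      then show ?thesis
        using u v bdry that by (simp add: zero_boundary_def fd_solution_def w_def)
    qed
    have "?E n \<le> ?E 0" if "n \<le> N" for n
      using that
    proof (induction n)
      case (Suc n)
      have "?E (n + 1) \<le> ?E n"
        using Suc.prems assms pos
        by (intro energy_step[where T = T and N = N and K\<^sub>\<alpha> = K\<^sub>\<alpha> and K\<^sub>\<beta> = K\<^sub>\<beta> and L\<^sub>a = L\<^sub>a and L\<^sub>b = L\<^sub>b]
            zero scheme_difference[OF u v, folded w_def]) auto
      also have "\<dots> \<le> ?E 0" using Suc by simp
      finally show ?case by simp
    qed simp
    then have "?E k \<le> ?E 0" using k by blast
    moreover have "D * ?S (w k) (w k) \<le> ?E k"
      unfolding D_def by (rule energy_bounds(1)[OF assms(1-4) zero[OF k]])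
    moreover have "?E 0 \<le> ?S (w 0) (w 0)" by (rule energy_bounds(2)[OF assms(1-4) zero]) simp
    moreover have "?S (w 0) (w 0) = ?S \<epsilon> \<epsilon>"
    proof -
      have "w 0 i j = \<epsilon> i j" if "i \<in> {1..M\<^sub>a - 1}" "j \<in> {1..M\<^sub>b - 1}" for i j
        using that by (intro w0) auto
      then show ?thesis unfolding interior_sum_def by (intro sum.cong refl) simp
    qed
    ultimately have "D * ?S (w k) (w k) \<le> ?S \<epsilon> \<epsilon>" by simp
    then have "?S (w k) (w k) \<le> ?S \<epsilon> \<epsilon> / D" using D by (simp add: pos_le_divide_eq mult.commute)
    then have "L\<^sub>a / real M\<^sub>a * (L\<^sub>b / real M\<^sub>b) * ?S (w k) (w k)
        \<le> L\<^sub>a / real M\<^sub>a * (L\<^sub>b / real M\<^sub>b) * (?S \<epsilon> \<epsilon> / D)"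
      using assms by (intro mult_left_mono) auto
    then have "grid_norm L\<^sub>a L\<^sub>b M\<^sub>a M\<^sub>b (w k) \<le> sqrt (L\<^sub>a / real M\<^sub>a * (L\<^sub>b / real M\<^sub>b) * ?S \<epsilon> \<epsilon> / D)"
      unfolding grid_norm_eq by simp
    also have "\<dots> = 1 / sqrt D * grid_norm L\<^sub>a L\<^sub>b M\<^sub>a M\<^sub>b \<epsilon>"
      unfolding grid_norm_eq real_sqrt_divide by simp
    finally show "grid_norm L\<^sub>a L\<^sub>b M\<^sub>a M\<^sub>b (\<lambda>i j. v k i j - u k i j)
        \<le> 1 / sqrt D * grid_norm L\<^sub>a L\<^sub>b M\<^sub>a M\<^sub>b \<epsilon>" by (simp add: w_def)
  qed (use D in simp)
qed

end
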